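(* Let $G$ be a group and $H\le G$ a subgroup. Then $G$ is hyperbolic relative to $H$ if and only if $H\hookrightarrow_h(G,X)$ for some finite subset $X\subseteq G$ with $G=\langle X\cup H\rangle$. Moreover, if $G$ is generated by $H$ together with a finite set, then here "for some finite subset $X$ with $G=\langle X\cup H\rangle$" may be equivalently replaced by "for any finite subset $X$ with $G=\langle X\cup H\rangle$".
   Context: Convention: generating sets are assumed symmetric (closed under inverses). Hyperbolic embedding. Let $X\subseteq G$ with $G=\langle X\cup H\rangle$. $\Gamma(G,X\sqcup H)$ is the Cayley graph of $G$ with respect to the alphabet $X\sqcup H$, where $X$ and $H$ are regarded as disjoint alphabets (an element represented both by a letter of $X$ and a letter of $H$ gives two differently labelled edges). Let $\Gamma_H$ be the Cayley graph of $H$ with respect to the generating set $H$, viewed as a complete subgraph of $\Gamma(G,X\sqcup H)$. A path in $\Gamma(G,X\sqcup H)$ is admissible if it contains no edges of $\Gamma_H$. For $h_1,h_2\in H$ let $\widehat{d}(h_1,h_2)\in[0,\infty]$ be the length of a shortest admissible path from $h_1$ to $h_2$ ($\infty$ if none). One writes $H\hookrightarrow_h(G,X)$ if (i) $G=\langle X\cup H\rangle$; (ii) $\Gamma(G,X\sqcup H)$ is hyperbolic; (iii) every ball of finite radius in $(H,\widehat{d})$ is finite. Relative hyperbolicity. $G$ is hyperbolic relative to $H$ if there are a finite set $X\subseteq G$ with $G=\langle X\cup H\rangle$ and a finite set $\mathcal R$ of elements of $H*F(X)$ (written as words in $X^{\pm 1}\sqcup H$) whose normal closure is the kernel of the natural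 epimorphism $H*F(X)\to G$, such that for some constant $C$, every word $W$ in $X^{\pm1}\sqcup H$ representing $1$ in $G$ can be written in $H*F(X)$ as $\prod_{i=1}^k f_i^{-1}R_i^{\pm1}f_i$ with $f_i\in H*F(X)$, $R_i\in\mathcal R$ and $k\le C\|W\|$, where $\|W\|$ is the length of $W$. *)

theory Defs
  imports
    "HOL-Algebra.Coset"
    "HOL-Algebra.Generated_Groups"
    "HOL-Library.Extended_Nat"
    "Graph_Theory.Arc_Walk"
begin

section \<open>Hyperbolic graphs\<close>

text \<open>
  Graphs are digraphs with named arcs, so multiple edges and loops are allowed.  An undirected edge
  is represented by a pair of opposite arcs.  All edges have length one.
\<close>

definition graph_dist :: "('v, 'e) pre_digraph \<Rightarrow> 'v \<Rightarrow> 'v \<Rightarrow> enat" where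
  "graph_dist \<Gamma> u v = (INF p \<in> {p. pre_digraph.awalk \<Gamma> u p v}. enat (length p))"

definition geodesic :: "('v, 'e) pre_digraph \<Rightarrow> 'v \<Rightarrow> 'e list \<Rightarrow> 'v \<Rightarrow> bool" where
  "geodesic \<Gamma> u p v \<longleftrightarrow>
     pre_digraph.awalk \<Gamma> u p v \<and> enat (length p) = graph_dist \<Gamma> u v"

text \<open>
  Rips' condition: all geodesic triangles are uniformly slim.  Since the sides are traversed
  cyclically and the condition is imposed on all triangles, requiring it for the first side
  requires it for every side.  Only vertices are tested; passing to the points inside the edges of
  the geometric realization affects nothing but the constant \<open>\<delta>\<close>.
\<close>

definition hyperbolic_graph :: "('v, 'e) pre_digraph \<Rightarrow> bool" where
  "hyperbolic_graph \<Gamma> \<longleftrightarrow>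
     (\<exists>\<delta>::nat. \<forall>x y z p q r.
        geodesic \<Gamma> x p y \<and> geodesic \<Gamma> y q z \<and> geodesic \<Gamma> z r x \<longrightarrow>
        (\<forall>a \<in> set (pre_digraph.awalk_verts \<Gamma> x p).
         \<exists>b \<in> set (pre_digraph.awalk_verts \<Gamma> y q) \<union> set (pre_digraph.awalk_verts \<Gamma> z r).
           graph_dist \<Gamma> a b \<le> enat \<delta>))"


section \<open>Hyperbolically embedded subgroups\<close>

definition inv_closed :: "('a, 'b) monoid_scheme \<Rightarrow> 'a set \<Rightarrow> bool" where
  "inv_closed G X \<longleftrightarrow> (\<forall>x \<in> X. inv\<^bsub>G\<^esub> x \<in> X)"

definition generates_over :: "('a, 'b) monoid_scheme \<Rightarrow> 'a set \<Rightarrow> 'a set \<Rightarrow> bool" where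
  "generates_over G H X \<longleftrightarrow> X \<subseteq> carrier G \<and> generate G (X \<union> H) = carrier G"

text \<open>
  The Cayley graph with respect to the disjoint alphabet \<open>X <+> H\<close>: the letter \<open>Inl x\<close> with
  \<open>x \<in> X\<close> stands for \<open>x\<close>, and \<open>Inr h\<close> with \<open>h \<in> H\<close> stands for \<open>h\<close>.  When \<open>X\<close> and \<open>H\<close> are closed
  under inverses, every arc has an opposite arc, so directed walks are edge paths.
\<close>

definition letter_val :: "'a + 'a \<Rightarrow> 'a" where
  "letter_val = case_sum id id"

definition cayley_graph ::
    "('a, 'b) monoid_scheme \<Rightarrow> 'a set \<Rightarrow> 'a set \<Rightarrow> ('a, 'a \<times> ('a + 'a)) pre_digraph" where
  "cayley_graph G X H =
     \<lparr> verts = carrier G,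
       arcs = carrier G \<times> (X <+> H),
       tail = fst,
       head = (\<lambda>(g, l). g \<otimes>\<^bsub>G\<^esub> letter_val l) \<rparr>"

text \<open>The complete subgraph spanned on \<open>H\<close> by the edges labelled by letters from \<open>H\<close>
  (but not by letters from \<open>X\<close>).\<close>

definition cayley_subgraph ::
    "('a, 'b) monoid_scheme \<Rightarrow> 'a set \<Rightarrow> ('a, 'a \<times> ('a + 'a)) pre_digraph" where
  "cayley_subgraph G H =
     \<lparr> verts = H,
       arcs = H \<times> Inr ` H,
       tail = fst,
       head = (\<lambda>(g, l). g \<otimes>\<^bsub>G\<^esub> letter_val l) \<rparr>"

definition admissible_path ::
    "('a, 'b) monoid_scheme \<Rightarrow> 'a set \<Rightarrow> 'a set \<Rightarrow> 'a \<Rightarrow> ('a \<times> ('a + 'a)) list \<Rightarrow> 'a \<Rightarrow> bool" where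
  "admissible_path G X H u p v \<longleftrightarrow>
     pre_digraph.awalk (cayley_graph G X H) u p v \<and> set p \<inter> arcs (cayley_subgraph G H) = {}"

text \<open>The infimum over the empty set is \<open>\<infinity>\<close>.\<close>

definition rel_dist :: "('a, 'b) monoid_scheme \<Rightarrow> 'a set \<Rightarrow> 'a set \<Rightarrow> 'a \<Rightarrow> 'a \<Rightarrow> enat" where
  "rel_dist G X H h\<^sub>1 h\<^sub>2 = (INF p \<in> {p. admissible_path G X H h\<^sub>1 p h\<^sub>2}. enat (length p))"

definition hyperbolically_embedded ::
    "('a, 'b) monoid_scheme \<Rightarrow> 'a set \<Rightarrow> 'a set \<Rightarrow> bool" where
  "hyperbolically_embedded G H X \<longleftrightarrow>
     generates_over G H X \<and>
     hyperbolic_graph (cayley_graph G X H) \<and>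
     (\<forall>h \<in> H. \<forall>n::nat. finite {h' \<in> H. rel_dist G X H h h' \<le> enat n})"


section \<open>The group \<open>H * F(X)\<close>\<close>

text \<open>
  Words in \<open>X\<close>, formal inverses of \<open>X\<close>, and \<open>H\<close>: the letters \<open>Inl (x, True)\<close> and \<open>Inl (x, False)\<close>
  stand for \<open>x\<close> and its formal inverse.  The group \<open>H * F(X)\<close> consists of the words modulo free
  cancellation in \<open>F(X)\<close> and the multiplication table of \<open>H\<close>.
\<close>

type_synonym 'a rel_word = "('a \<times> bool + 'a) list"

definition rel_words :: "'a set \<Rightarrow> 'a set \<Rightarrow> 'a rel_word set" where
  "rel_words H X = lists ((X \<times> UNIV) <+> H)"

inductive word_reduction ::
    "('a, 'b) monoid_scheme \<Rightarrow> 'a set \<Rightarrow> 'a set \<Rightarrow> 'a rel_word \<Rightarrow> 'a rel_word \<Rightarrow> bool"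
  for G H X where
  cancel: "u \<in> rel_words H X \<Longrightarrow> v \<in> rel_words H X \<Longrightarrow> x \<in> X \<Longrightarrow>
     word_reduction G H X (u @ [Inl (x, b), Inl (x, \<not> b)] @ v) (u @ v)"
| mult: "u \<in> rel_words H X \<Longrightarrow> v \<in> rel_words H X \<Longrightarrow> h \<in> H \<Longrightarrow> h' \<in> H \<Longrightarrow>
     word_reduction G H X (u @ [Inr h, Inr h'] @ v) (u @ [Inr (h \<otimes>\<^bsub>G\<^esub> h')] @ v)"
| one: "u \<in> rel_words H X \<Longrightarrow> v \<in> rel_words H X \<Longrightarrow>
     word_reduction G H X (u @ [Inr \<one>\<^bsub>G\<^esub>] @ v) (u @ v)"

definition word_equiv ::
    "('a, 'b) monoid_scheme \<Rightarrow> 'a set \<Rightarrow> 'a set \<Rightarrow> ('a rel_word \<times> 'a rel_word) set" where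
  "word_equiv G H X =
     {(u, v) \<in> rel_words H X \<times> rel_words H X. equivclp (word_reduction G H X) u v}"

definition word_class ::
    "('a, 'b) monoid_scheme \<Rightarrow> 'a set \<Rightarrow> 'a set \<Rightarrow> 'a rel_word \<Rightarrow> 'a rel_word set" where
  "word_class G H X w = word_equiv G H X `` {w}"

definition free_prod ::
    "('a, 'b) monoid_scheme \<Rightarrow> 'a set \<Rightarrow> 'a set \<Rightarrow> 'a rel_word set monoid" where
  "free_prod G H X =
     \<lparr> carrier = rel_words H X // word_equiv G H X,
       mult = (\<lambda>U V. \<Union>u \<in> U. \<Union>v \<in> V. word_class G H X (u @ v)),
       one = word_class G H X [] \<rparr>"

fun rel_letter_val :: "('a, 'b) monoid_scheme \<Rightarrow> 'a \<times> bool + 'a \<Rightarrow> 'a" where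
  "rel_letter_val G (Inl (x, b)) = (if b then x else inv\<^bsub>G\<^esub> x)"
| "rel_letter_val G (Inr h) = h"

definition word_val :: "('a, 'b) monoid_scheme \<Rightarrow> 'a rel_word \<Rightarrow> 'a" where
  "word_val G w = foldr (\<otimes>\<^bsub>G\<^esub>) (map (rel_letter_val G) w) \<one>\<^bsub>G\<^esub>"

text \<open>The natural epimorphism; \<open>word_val\<close> is constant on equivalence classes of words
  (lemma \<open>natural_epi_word_class\<close> below).\<close>

definition natural_epi :: "('a, 'b) monoid_scheme \<Rightarrow> 'a rel_word set \<Rightarrow> 'a" where
  "natural_epi G U = the_elem (word_val G ` U)"


section \<open>Relative hyperbolicity\<close>

definition normal_closure :: "('a, 'b) monoid_scheme \<Rightarrow> 'a set \<Rightarrow> 'a set" where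
  "normal_closure G S = \<Inter>{N. N \<lhd> G \<and> S \<subseteq> N}"

definition linear_rel_isoperimetric ::
    "('a, 'b) monoid_scheme \<Rightarrow> 'a set \<Rightarrow> 'a set \<Rightarrow> 'a rel_word set set \<Rightarrow> bool" where
  "linear_rel_isoperimetric G H X R \<longleftrightarrow>
     (\<exists>C::real. \<forall>W \<in> rel_words H X. word_val G W = \<one>\<^bsub>G\<^esub> \<longrightarrow>
        (\<exists>frs. set frs \<subseteq>
             carrier (free_prod G H X) \<times> (R \<union> m_inv (free_prod G H X) ` R) \<and>
           word_class G H X W =
             foldr (\<otimes>\<^bsub>free_prod G H X\<^esub>)
               (map (\<lambda>(f, r). inv\<^bsub>free_prod G H X\<^esub> f \<otimes>\<^bsub>free_prod G H X\<^esub> r \<otimes>\<^bsub>free_prod G H X\<^esub> f) frs)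
               \<one>\<^bsub>free_prod G H X\<^esub> \<and>
           real (length frs) \<le> C * real (length W)))"

text \<open>No symmetry is required of \<open>X\<close> here, since formal inverses are letters anyway.\<close>

definition relatively_hyperbolic :: "('a, 'b) monoid_scheme \<Rightarrow> 'a set \<Rightarrow> bool" where
  "relatively_hyperbolic G H \<longleftrightarrow>
     (\<exists>X R. finite X \<and> generates_over G H X \<and>
        finite R \<and> R \<subseteq> carrier (free_prod G H X) \<and>
        normal_closure (free_prod G H X) R = kernel (free_prod G H X) G (natural_epi G) \<and>
        linear_rel_isoperimetric G H X R)"


section \<open>Well-definedness of \<open>H * F(X)\<close> and of its natural epimorphism\<close>

lemma equiv_word_equiv: "equiv (rel_words H X) (word_equiv G H X)"
  unfolding word_equiv_def
  by (auto intro!: equivI refl_onI symI transI elim: equivclp_sym equivclp_trans)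

lemma word_reduction_context:
  assumes "word_reduction G H X u v" "a \<in> rel_words H X" "b \<in> rel_words H X"
  shows "word_reduction G H X (a @ u @ b) (a @ v @ b)"
  using assms(1)
proof cases
  case (cancel u' v' x c)
  then show ?thesis
    using word_reduction.cancel[of "a @ u'" H X "v' @ b" x G c] assms(2,3)
    by (simp add: rel_words_def)
next
  case (mult u' v' h h')
  then show ?thesis
    using word_reduction.mult[of "a @ u'" H X "v' @ b" h h' G] assms(2,3)
    by (simp add: rel_words_def)
next
  case (one u' v')
  then show ?thesis
    using word_reduction.one[of "a @ u'" H X "v' @ b" G] assms(2,3)
    by (simp add: rel_words_def)
qed

lemma equivclp_context:
  assumes "equivclp (word_reduction G H X) u v" "a \<in> rel_words H X" "b \<in> rel_words H X"
  shows "equivclp (word_reduction G H X) (a @ u @ b) (a @ v @ b)"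
  using assms(1)
proof (induction rule: equivclp_induct)
  case base
  then show ?case by simp
next
  case (step y z)
  then have "equivclp (word_reduction G H X) (a @ y @ b) (a @ z @ b)"
    using word_reduction_context[OF _ assms(2,3)] by blast
  with step.IH show ?case by (rule equivclp_trans)
qed

lemma word_equiv_append:
  assumes "(u, u') \<in> word_equiv G H X" "(v, v') \<in> word_equiv G H X"
  shows "(u @ v, u' @ v') \<in> word_equiv G H X"
proof -
  have *: "u \<in> rel_words H X" "u' \<in> rel_words H X" "v \<in> rel_words H X" "v' \<in> rel_words H X"
    "equivclp (word_reduction G H X) u u'" "equivclp (word_reduction G H X) v v'"
    using assms by (auto simp: word_equiv_def)
  have "[] \<in> rel_words H X" by (simp add: rel_words_def)
  then have "equivclp (word_reduction G H X) (u @ v) (u' @ v)"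
       "equivclp (word_reduction G H X) (u' @ v) (u' @ v')"
    using equivclp_context[of G H X u u' "[]" v] equivclp_context[of G H X v v' u' "[]"] *
    by simp_all
  then have "equivclp (word_reduction G H X) (u @ v) (u' @ v')" by (rule equivclp_trans)
  then show ?thesis using * by (auto simp: word_equiv_def rel_words_def)
qed

lemma word_class_mult:
  assumes "u \<in> rel_words H X" "v \<in> rel_words H X"
  shows "word_class G H X u \<otimes>\<^bsub>free_prod G H X\<^esub> word_class G H X v = word_class G H X (u @ v)"
proof -
  have "word_class G H X (u' @ v') = word_class G H X (u @ v)"
    if "u' \<in> word_class G H X u" "v' \<in> word_class G H X v" for u' v'
  proof -
    have "(u @ v, u' @ v') \<in> word_equiv G H X"
      using that by (intro word_equiv_append) (simp_all add: word_class_def)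
    then show ?thesis
      unfolding word_class_def by (rule equiv_class_eq[OF equiv_word_equiv, symmetric])
  qed
  moreover have "u \<in> word_class G H X u" "v \<in> word_class G H X v"
    using assms equiv_class_self[OF equiv_word_equiv] by (auto simp: word_class_def)
  ultimately have "(\<Union>u' \<in> word_class G H X u. \<Union>v' \<in> word_class G H X v. word_class G H X (u' @ v'))
      = word_class G H X (u @ v)"
    by blast
  then show ?thesis by (simp add: free_prod_def)
qed

lemma carrier_free_prod: "carrier (free_prod G H X) = word_class G H X ` rel_words H X"
  by (auto simp: free_prod_def quotient_def word_class_def)

lemma word_class_eqI:
  assumes "word_reduction G H X u v" "u \<in> rel_words H X" "v \<in> rel_words H X"
  shows "word_class G H X u = word_class G H X v"
  unfolding word_class_def
  by (rule equiv_class_eq[OF equiv_word_equiv])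
     (use assms in \<open>auto simp: word_equiv_def\<close>)

lemma group_free_prod:
  assumes "group G" "subgroup H G"
  shows "group (free_prod G H X)"
proof -
  interpret G: group G by fact
  interpret H: subgroup H G by fact
  let ?F = "free_prod G H X" and ?c = "word_class G H X"
  have nil: "[] \<in> rel_words H X" by (simp add: rel_words_def)
  have app: "u @ v \<in> rel_words H X" if "u \<in> rel_words H X" "v \<in> rel_words H X" for u v
    using that by (simp add: rel_words_def)
  have one: "\<one>\<^bsub>?F\<^esub> = ?c []" by (simp add: free_prod_def)
  have linv: "\<exists>v \<in> rel_words H X. ?c (v @ u) = ?c []" if "u \<in> rel_words H X" for u
    using that
  proof (induction u)
    case Nil
    then show ?case using nil by auto
  next
    case (Cons l u)
    then have u: "u \<in> rel_words H X" and l: "l \<in> (X \<times> UNIV) <+> H"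
      by (auto simp: rel_words_def)
    obtain v where v: "v \<in> rel_words H X" "?c (v @ u) = ?c []"
      using Cons.IH[OF u] by auto
    obtain l' where l': "l' \<in> (X \<times> UNIV) <+> H" "?c (v @ [l', l] @ u) = ?c (v @ u)"
    proof (cases l)
      case (Inl xb)
      obtain x b where "l = Inl (x, b)" "x \<in> X" using l Inl by (cases xb) auto
      have "?c (v @ [Inl (x, \<not> b), Inl (x, b)] @ u) = ?c (v @ u)"
        using word_reduction.cancel[OF v(1) u, of x G "\<not> b"] \<open>x \<in> X\<close> v(1) u
        by (intro word_class_eqI) (auto simp: rel_words_def)
      then show ?thesis using that[of "Inl (x, \<not> b)"] \<open>l = Inl (x, b)\<close> \<open>x \<in> X\<close> by auto
    next
      case (Inr h)
      then have h: "h \<in> H" "inv\<^bsub>G\<^esub> h \<in> H" "inv\<^bsub>G\<^esub> h \<otimes>\<^bsub>G\<^esub> h = \<one>\<^bsub>G\<^esub>" using l by auto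
      have "?c (v @ [Inr (inv\<^bsub>G\<^esub> h), Inr h] @ u) = ?c (v @ [Inr \<one>\<^bsub>G\<^esub>] @ u)"
        using word_reduction.mult[OF v(1) u h(2,1), of G] h v(1) u
        by (intro word_class_eqI) (auto simp: rel_words_def)
      also have "\<dots> = ?c (v @ u)"
        using word_reduction.one[OF v(1) u, of G] v(1) u
        by (intro word_class_eqI) (auto simp: rel_words_def)
      finally show ?thesis using that[of "Inr (inv\<^bsub>G\<^esub> h)"] h Inr by auto
    qed
    then have "?c ((v @ [l']) @ l # u) = ?c []" using v by simp
    moreover have "v @ [l'] \<in> rel_words H X" using v l' by (simp add: rel_words_def)
    ultimately show ?case by blast
  qed
  show ?thesis
  proof (rule groupI)
    fix a b assume "a \<in> carrier ?F" "b \<in> carrier ?F"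
    then show "a \<otimes>\<^bsub>?F\<^esub> b \<in> carrier ?F"
      by (auto simp: carrier_free_prod word_class_mult app)
  next
    fix a b c assume "a \<in> carrier ?F" "b \<in> carrier ?F" "c \<in> carrier ?F"
    then show "a \<otimes>\<^bsub>?F\<^esub> b \<otimes>\<^bsub>?F\<^esub> c = a \<otimes>\<^bsub>?F\<^esub> (b \<otimes>\<^bsub>?F\<^esub> c)"
      by (auto simp: carrier_free_prod word_class_mult app)
  next
    fix a assume "a \<in> carrier ?F"
    then obtain u where u: "u \<in> rel_words H X" "a = ?c u" by (auto simp: carrier_free_prod)
    then show "\<one>\<^bsub>?F\<^esub> \<otimes>\<^bsub>?F\<^esub> a = a" by (simp add: one word_class_mult nil)
    show "\<exists>b \<in> carrier ?F. b \<otimes>\<^bsub>?F\<^esub> a = \<one>\<^bsub>?F\<^esub>"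
      using linv[OF u(1)] u by (force simp: carrier_free_prod one word_class_mult)
  qed (simp add: one carrier_free_prod nil)
qed

context
  fixes G (structure) and H X
  assumes G: "group G" and H: "subgroup H G" and X: "X \<subseteq> carrier G"
begin

interpretation group G by (fact G)
interpretation H: subgroup H G by (fact H)

lemma rel_letter_val_closed: "l \<in> (X \<times> UNIV) <+> H \<Longrightarrow> rel_letter_val G l \<in> carrier G"
  using X by (auto split: if_splits)

lemma word_val_closed: "w \<in> rel_words H X \<Longrightarrow> word_val G w \<in> carrier G"
  by (induction w) (auto simp: rel_words_def word_val_def rel_letter_val_closed)

lemma word_val_append:
  "u \<in> rel_words H X \<Longrightarrow> v \<in> rel_words H X \<Longrightarrow>
     word_val G (u @ v) = word_val G u \<otimes> word_val G v"
proof (induction u)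
  case Nil
  then show ?case using word_val_closed[of v] by (simp add: word_val_def)
next
  case (Cons l u)
  then have "u \<in> rel_words H X" "rel_letter_val G l \<in> carrier G"
    by (auto simp: rel_words_def intro!: rel_letter_val_closed)
  with Cons show ?case
    using word_val_closed[of u] word_val_closed[of v] by (simp add: word_val_def m_assoc)
qed

lemma word_val_reduction:
  assumes "word_reduction G H X u v"
  shows "word_val G u = word_val G v"
  using assms
proof cases
  case (cancel u' v' x b)
  have "[Inl (x, b), Inl (x, \<not> b)] \<in> rel_words H X" "x \<in> carrier G"
    using cancel X by (auto simp: rel_words_def)
  then show ?thesis
    using cancel word_val_closed[of u'] word_val_closed[of v']
      word_val_append[of u' "[Inl (x, b), Inl (x, \<not> b)] @ v'"]
      word_val_append[of "[Inl (x, b), Inl (x, \<not> b)]" v'] word_val_append[of u' v']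
    by (auto simp: word_val_def rel_words_def)
next
  case (mult u' v' h h')
  have "[Inr h, Inr h'] \<in> rel_words H X" "[Inr (h \<otimes> h')] \<in> rel_words H X"
    using mult by (auto simp: rel_words_def)
  then show ?thesis
    using mult word_val_closed[of u'] word_val_closed[of v']
      word_val_append[of u' "[Inr h, Inr h'] @ v'"] word_val_append[of "[Inr h, Inr h']" v']
      word_val_append[of u' "[Inr (h \<otimes> h')] @ v'"] word_val_append[of "[Inr (h \<otimes> h')]" v']
    by (auto simp: word_val_def rel_words_def)
next
  case (one u' v')
  have "[Inr \<one>] \<in> rel_words H X" by (auto simp: rel_words_def)
  then show ?thesis
    using one word_val_closed[of u'] word_val_closed[of v']
      word_val_append[of u' "[Inr \<one>] @ v'"] word_val_append[of "[Inr \<one>]" v']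
      word_val_append[of u' v']
    by (auto simp: word_val_def rel_words_def)
qed

lemma word_val_equiv:
  assumes "(u, v) \<in> word_equiv G H X"
  shows "word_val G u = word_val G v"
proof -
  have "equivclp (word_reduction G H X) u v" using assms by (simp add: word_equiv_def)
  then show ?thesis
    by (induction rule: equivclp_induct) (auto dest: word_val_reduction)
qed

lemma natural_epi_word_class:
  assumes "w \<in> rel_words H X"
  shows "natural_epi G (word_class G H X w) = word_val G w"
proof -
  have "w \<in> word_class G H X w"
    using assms equiv_class_self[OF equiv_word_equiv] by (auto simp: word_class_def)
  then have "word_val G ` word_class G H X w = {word_val G w}"
    by (auto simp: word_class_def dest: word_val_equiv)
  then show ?thesis by (simp add: natural_epi_def)
qed

lemma natural_epi_hom: "natural_epi G \<in> hom (free_prod G H X) G"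
proof -
  have "u @ v \<in> rel_words H X" if "u \<in> rel_words H X" "v \<in> rel_words H X" for u v
    using that by (simp add: rel_words_def)
  then show ?thesis
    by (auto simp: hom_def carrier_free_prod natural_epi_word_class word_class_mult
        word_val_append word_val_closed)
qed

lemma natural_epi_surj:
  assumes "generates_over G H X"
  shows "natural_epi G ` carrier (free_prod G H X) = carrier G"
proof -
  interpret F: group "free_prod G H X" by (rule group_free_prod) (fact G, fact H)
  interpret hom: group_hom "free_prod G H X" G "natural_epi G"
    by unfold_locales (rule natural_epi_hom)
  let ?I = "natural_epi G ` carrier (free_prod G H X)"
  have "X \<union> H \<subseteq> ?I"
  proof
    fix g assume g: "g \<in> X \<union> H"
    obtain l where "l \<in> (X \<times> UNIV) <+> H" "rel_letter_val G l = g"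
    proof (cases "g \<in> X")
      case True
      then show ?thesis using that[of "Inl (g, True)"] by auto
    next
      case False
      then show ?thesis using that[of "Inr g"] g by auto
    qed
    moreover from this have "[l] \<in> rel_words H X" "g \<in> carrier G"
      using rel_letter_val_closed[of l] by (auto simp: rel_words_def)
    ultimately show "g \<in> ?I"
      using natural_epi_word_class[of "[l]"] by (force simp: carrier_free_prod word_val_def)
  qed
  then have "generate G (X \<union> H) \<subseteq> ?I"
    by (intro generate_subgroup_incl hom.img_is_subgroup)
  moreover have "?I \<subseteq> carrier G" using hom.img_is_subgroup by (rule subgroup.subset)
  ultimately show ?thesis using assms by (auto simp: generates_over_def)
qed

end

end

theory Submission
  imports Defs
begin

text \<open>
  Loops are measured against cochains: a linear isoperimetric inequality over finitely many relators
  bounds the integral over a loop of every cochain that is bounded on the relators and exact on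
  the cosets of \<open>H\<close>.  Testing with a discrete \<open>\<psi> d\<phi>\<close>, where \<open>\<phi>\<close> is a distance and \<open>\<psi>\<close> a bump function
  around a vertex of a maximally fat geodesic triangle, gives hyperbolicity by Stokes'
  theorem, without planar diagrams.  Testing with the differential of a word length on the coset \<open>H\<close>
  gives finiteness of balls for the relative metric.  Conversely, Dehn's algorithm in the
  hyperbolic Cayley graph reduces loops to short loops, and a short loop is cut along connected edges
  labelled in \<open>H\<close> until all its \<open>H\<close>-letters lie in a finite ball of the relative metric.
\<close>

section \<open>Slim triangles in discrete geodesic spaces\<close>

text \<open>When \<open>H\<close> is infinite, so is the alphabet: the Cayley graph is not locally
  finite, and a vertex may lie on infinitely many loops of a given length. Areas in
  \<open>H * F(X)\<close>, however, count only the relators in \<open>R\<close>; the multiplication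
  table of \<open>H\<close> is free of charge. Cochains that are additive along
  \<open>H\<close>-labelled edges are the functionals blind to that table. They may be arbitrarily
  large on a single \<open>H\<close>-edge, and this is what makes them detect the relative metric.

  Evaluating fillings instead of manipulating them also settles the change of generating set. The
  presentation comes with its own set \<open>Y\<close>, and pulling cochains back along a
  substitution carries the estimate from \<open>Y\<close> to any finite \<open>X\<close>; this is
  the source of "for any" in the second equivalence.

  A form \<psi> d\<phi> need not be exact on cosets of \<open>H\<close>, but these have diameter at
  most one, so the correction costs a bounded amount per edge. A bump of radius \<open>D\<close> has
  integral of order \<open>D^2\<close> along a geodesic through its centre, while the loop around a
  fat triangle can be kept of length of order \<open>D\<close>; hence a linear inequality bounds
  \<open>D\<close>.\<close>

locale integer_geodesic_space =
  fixes V :: "'v set" and d :: "'v \<Rightarrow> 'v \<Rightarrow> nat"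
  assumes dist_self: "u \<in> V \<Longrightarrow> d u u = 0"
    and dist_sym: "u \<in> V \<Longrightarrow> v \<in> V \<Longrightarrow> d u v = d v u"
    and dist_triangle: "u \<in> V \<Longrightarrow> v \<in> V \<Longrightarrow> w \<in> V \<Longrightarrow> d u w \<le> d u v + d v w"
    and geodesics_exist: "u \<in> V \<Longrightarrow> v \<in> V \<Longrightarrow>
      \<exists>\<gamma>. \<gamma> 0 = u \<and> \<gamma> (d u v) = v \<and> (\<forall>i \<le> d u v. \<gamma> i \<in> V) \<and>
        (\<forall>i < d u v. d (\<gamma> i) (\<gamma> (Suc i)) \<le> 1)"
begin

definition geod :: "(nat \<Rightarrow> 'v) \<Rightarrow> nat \<Rightarrow> bool" where
  "geod \<gamma> n \<longleftrightarrow> (\<forall>i\<le>n. \<gamma> i \<in> V) \<and> (\<forall>i j. i \<le> j \<longrightarrow> j \<le> n \<longrightarrow> d (\<gamma> i) (\<gamma> j) = j - i)"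

text \<open>The perimeter bound \<open>N\<close> makes a least slimness constant available before
  hyperbolicity is known, because \<delta> = \<open>N\<close> always works.
  \<open>slim_if_stokes\<close> bounds that constant independently of \<open>N\<close>.\<close>

definition slim :: "nat \<Rightarrow> nat \<Rightarrow> bool" where
  "slim \<delta> N \<longleftrightarrow>
     (\<forall>\<alpha> \<beta> \<gamma> l m n. geod \<alpha> l \<longrightarrow> geod \<beta> m \<longrightarrow> geod \<gamma> n \<longrightarrow>
        \<alpha> l = \<beta> 0 \<longrightarrow> \<beta> m = \<gamma> 0 \<longrightarrow> \<gamma> n = \<alpha> 0 \<longrightarrow> l + m + n \<le> N \<longrightarrow>
        (\<forall>i\<le>l. \<exists>b \<in> \<beta> ` {..m} \<union> \<gamma> ` {..n}. d (\<alpha> i) b \<le> \<delta>))"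

lemma slimD:
  assumes "slim \<delta> N" "geod \<alpha> l" "geod \<beta> m" "geod \<gamma> n"
    and "\<alpha> l = \<beta> 0" "\<beta> m = \<gamma> 0" "\<gamma> n = \<alpha> 0" "l + m + n \<le> N" "i \<le> l"
  obtains b where "b \<in> \<beta> ` {..m} \<union> \<gamma> ` {..n}" "d (\<alpha> i) b \<le> \<delta>"
proof -
  have "\<forall>i\<le>l. \<exists>b \<in> \<beta> ` {..m} \<union> \<gamma> ` {..n}. d (\<alpha> i) b \<le> \<delta>"
    using assms(1)[unfolded slim_def, rule_format, OF assms(2-8)] by simp
  then show ?thesis using that assms(9) by blast
qed

lemma slim_mono: "slim \<delta> N \<Longrightarrow> \<delta> \<le> \<delta>' \<Longrightarrow> slim \<delta>' N"
  unfolding slim_def[of \<delta>']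
proof (intro allI impI)
  fix \<alpha> \<beta> \<gamma> l m n i
  assume "slim \<delta> N" "\<delta> \<le> \<delta>'" and t: "geod \<alpha> l" "geod \<beta> m" "geod \<gamma> n"
    "\<alpha> l = \<beta> 0" "\<beta> m = \<gamma> 0" "\<gamma> n = \<alpha> 0" "l + m + n \<le> N" "i \<le> l"
  obtain b where "b \<in> \<beta> ` {..m} \<union> \<gamma> ` {..n}" "d (\<alpha> i) b \<le> \<delta>"
    by (rule slimD[OF \<open>slim \<delta> N\<close> t])
  then show "\<exists>b \<in> \<beta> ` {..m} \<union> \<gamma> ` {..n}. d (\<alpha> i) b \<le> \<delta>'"
    using \<open>\<delta> \<le> \<delta>'\<close> by (meson order_trans)
qed

lemma geod_in: "geod \<gamma> n \<Longrightarrow> i \<le> n \<Longrightarrow> \<gamma> i \<in> V"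
  by (simp add: geod_def)

lemma geod_dist: "geod \<gamma> n \<Longrightarrow> i \<le> j \<Longrightarrow> j \<le> n \<Longrightarrow> d (\<gamma> i) (\<gamma> j) = j - i"
  by (simp add: geod_def)

lemma geod_dist': "geod \<gamma> n \<Longrightarrow> i \<le> n \<Longrightarrow> j \<le> n \<Longrightarrow> d (\<gamma> i) (\<gamma> j) = (j - i) + (i - j)"
  using geod_dist[of \<gamma> n i j] geod_dist[of \<gamma> n j i] dist_sym[of "\<gamma> i" "\<gamma> j"]
    geod_in[of \<gamma> n i] geod_in[of \<gamma> n j]
  by (cases "i \<le> j") simp_all

lemma geod_sub: "geod \<gamma> n \<Longrightarrow> k + m \<le> n \<Longrightarrow> geod (\<lambda>i. \<gamma> (k + i)) m"
  by (auto simp: geod_def)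

text \<open>Each piece of the path is at most as long as its number of steps; since three
  consecutive pieces must add up to the distance of the ends, none of them can fall short.\<close>

lemma geodI:
  assumes "\<And>i. i \<le> n \<Longrightarrow> \<gamma> i \<in> V" "\<And>i. i < n \<Longrightarrow> d (\<gamma> i) (\<gamma> (Suc i)) \<le> 1"
    and "n \<le> d (\<gamma> 0) (\<gamma> n)"
  shows "geod \<gamma> n"
proof -
  have le: "d (\<gamma> i) (\<gamma> (i + k)) \<le> k" if "i + k \<le> n" for i k
    using that
  proof (induction k)
    case 0 then show ?case using assms(1) dist_self by simp
  next
    case (Suc k)
    have "d (\<gamma> i) (\<gamma> (i + Suc k)) \<le> d (\<gamma> i) (\<gamma> (i + k)) + d (\<gamma> (i + k)) (\<gamma> (Suc (i + k)))"
      using Suc.prems by (simp add: dist_triangle assms(1))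
    then show ?case using Suc assms(2)[of "i + k"] by simp
  qed
  have "d (\<gamma> i) (\<gamma> j) = j - i" if "i \<le> j" "j \<le> n" for i j
  proof -
    have "d (\<gamma> 0) (\<gamma> n) \<le> d (\<gamma> 0) (\<gamma> i) + d (\<gamma> i) (\<gamma> n)"
      "d (\<gamma> i) (\<gamma> n) \<le> d (\<gamma> i) (\<gamma> j) + d (\<gamma> j) (\<gamma> n)"
      using that by (simp_all add: dist_triangle assms(1))
    moreover have "d (\<gamma> 0) (\<gamma> i) \<le> i" "d (\<gamma> i) (\<gamma> j) \<le> j - i" "d (\<gamma> j) (\<gamma> n) \<le> n - j"
      using le[of 0 i] le[of i "j - i"] le[of j "n - j"] that by simp_all
    ultimately show ?thesis using assms(3) that by linarith
  qed
  then show ?thesis using assms(1) by (simp add: geod_def)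
qed

lemma geod_between:
  assumes "u \<in> V" "v \<in> V"
  obtains \<gamma> where "geod \<gamma> (d u v)" "\<gamma> 0 = u" "\<gamma> (d u v) = v"
proof -
  obtain \<gamma> where g: "\<gamma> 0 = u" "\<gamma> (d u v) = v" "\<forall>i \<le> d u v. \<gamma> i \<in> V"
      "\<forall>i < d u v. d (\<gamma> i) (\<gamma> (Suc i)) \<le> 1"
    using geodesics_exist[OF assms] by auto
  show ?thesis by (rule that[of \<gamma>]) (use g in \<open>auto intro!: geodI\<close>)
qed

text \<open>The vertex furthest from the base point of a locally geodesic loop lies in the middle of a
  geodesic subpath; slimness of the triangle over it makes an end of the subpath still further.\<close>

lemma slim_loop_not_local_geodesic:
  assumes slim: "\<And>N. slim \<delta> N" and m: "m = 2 * \<delta> + 1" and n: "2 * m \<le> n"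
    and c: "\<And>i. i \<le> n \<Longrightarrow> c i \<in> V" "c n = c 0"
  shows "\<exists>k. k + 2 * m \<le> n \<and> \<not> geod (\<lambda>i. c (k + i)) (2 * m)"
proof (rule ccontr)
  assume "\<not> ?thesis"
  then have loc: "geod (\<lambda>i. c (k + i)) (2 * m)" if "k + 2 * m \<le> n" for k using that by blast
  define D where "D = Max ((\<lambda>i. d (c i) (c 0)) ` {..n})"
  obtain t where t: "t \<le> n" "d (c t) (c 0) = D"
  proof -
    have "D \<in> (\<lambda>i. d (c i) (c 0)) ` {..n}" unfolding D_def by (intro Max_in) auto
    then show ?thesis using that by auto
  qed
  have maxi: "d (c i) (c 0) \<le> D" if "i \<le> n" for i
    unfolding D_def using that by (intro Max_ge) auto
  have c0: "c 0 \<in> V" using c by simp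
  \<comment> \<open>Near both ends of the loop the distance to \<open>c 0\<close> is known exactly.
    A vertex with fewer than \<open>m\<close> steps on one side is nearer to \<open>c 0\<close> than
    the vertex \<open>2 * m\<close> steps from that end, so it is not the furthest one.\<close>
  have left: "d (c i) (c 0) = i" if "i \<le> 2 * m" for i
    using geod_dist[OF loc[of 0], of 0 i] that n dist_sym[OF c(1)[of i] c0] by simp
  have right: "d (c i) (c 0) = n - i" if "n - 2 * m \<le> i" "i \<le> n" for i
    using geod_dist[OF loc[of "n - 2 * m"], of "i - (n - 2 * m)" "2 * m"] that n c(2) by auto
  have mt: "m \<le> t"
  proof (rule ccontr)
    assume "\<not> m \<le> t"
    then show False using left[of t] left[of "2 * m"] maxi[of "2 * m"] t n m by simp
  qed
  have tm: "t + m \<le> n"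
  proof (rule ccontr)
    assume "\<not> t + m \<le> n"
    then show False using right[of t] right[of "n - 2 * m"] maxi[of "n - 2 * m"] t n m by simp
  qed
  define y where "y = c (t - m)"
  define z where "z = c (t + m)"
  have yz: "y \<in> V" "z \<in> V" "c t \<in> V" using c(1) t(1) tm by (auto simp: y_def z_def)
  have ge: "geod (\<lambda>i. c ((t - m) + i)) (2 * m)" using loc[of "t - m"] mt tm by simp
  have dy: "d (c t) y = m" "d (c t) z = m"
    using geod_dist'[OF ge, of m 0] geod_dist'[OF ge, of m "2 * m"] mt by (simp_all add: y_def z_def add.commute)
  obtain \<beta> where b: "geod \<beta> (d z (c 0))" "\<beta> 0 = z" "\<beta> (d z (c 0)) = c 0"
    by (rule geod_between[OF yz(2) c0])
  obtain \<gamma> where g: "geod \<gamma> (d (c 0) y)" "\<gamma> 0 = c 0" "\<gamma> (d (c 0) y) = y"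
    by (rule geod_between[OF c0 yz(1)])
  obtain w where w: "w \<in> \<beta> ` {..d z (c 0)} \<union> \<gamma> ` {..d (c 0) y}" "d (c t) w \<le> \<delta>"
  proof (rule slimD[OF slim ge b(1) g(1), of "2 * m + d z (c 0) + d (c 0) y" m])
    show "c (t - m + 2 * m) = \<beta> 0" using b mt by (simp add: z_def add.commute)
  qed (use b g mt in \<open>auto simp: y_def\<close>)
  have wV: "w \<in> V" using w(1) geod_in[OF b(1)] geod_in[OF g(1)] by auto
  have tri1: "d (c t) (c 0) \<le> d (c t) w + d w (c 0)" using dist_triangle yz wV c0 by blast
  \<comment> \<open>The near point \<open>w\<close> lies on a geodesic from one end of the subpath
    to \<open>c 0\<close>, so that end has distance at least (m - \<delta>) + (D - \<delta>) = D + 1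
    from \<open>c 0\<close>. This is where m = 2\<delta> + 1 comes from.\<close>
  from w(1) show False
  proof
    assume "w \<in> \<beta> ` {..d z (c 0)}"
    then obtain j where "j \<le> d z (c 0)" "w = \<beta> j" by auto
    then have "d z w + d w (c 0) = d z (c 0)"
      using geod_dist[OF b(1), of 0 j] geod_dist[OF b(1), of j "d z (c 0)"] b by simp
    moreover have "d (c t) z \<le> d (c t) w + d z w"
      using dist_triangle[of "c t" w z] dist_sym[OF wV yz(2)] yz wV by simp
    moreover have "d z (c 0) \<le> D" using maxi tm by (simp add: z_def)
    ultimately show False using tri1 t(2) w(2) dy m by linarith
  next
    assume "w \<in> \<gamma> ` {..d (c 0) y}"
    then obtain j where "j \<le> d (c 0) y" "w = \<gamma> j" by auto
    then have "d y w + d w (c 0) = d y (c 0)"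
      using geod_dist[OF g(1), of 0 j] geod_dist[OF g(1), of j "d (c 0) y"] g
      using dist_sym c0 yz wV by simp
    moreover have "d (c t) y \<le> d (c t) w + d y w"
      using dist_triangle[of "c t" w y] dist_sym[OF wV yz(1)] yz wV by simp
    moreover have "d y (c 0) \<le> D" using maxi t by (simp add: y_def)
    ultimately show False using tri1 t(2) w(2) dy m by linarith
  qed
qed

section \<open>Discrete line integrals and paths outside a ball\<close>

primrec edge_path :: "'v \<Rightarrow> 'v list \<Rightarrow> bool" where
  "edge_path u [] \<longleftrightarrow> True"
| "edge_path u (v # vs) \<longleftrightarrow> v \<in> V \<and> d u v \<le> 1 \<and> edge_path v vs"

text \<open>A left Riemann-Stieltjes sum for the integral of \<psi> d\<phi>.\<close>

primrec line_int :: "('v \<Rightarrow> real) \<Rightarrow> ('v \<Rightarrow> real) \<Rightarrow> 'v \<Rightarrow> 'v list \<Rightarrow> real" where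
  "line_int \<psi> \<phi> u [] = 0"
| "line_int \<psi> \<phi> u (v # vs) = \<psi> u * (\<phi> v - \<phi> u) + line_int \<psi> \<phi> v vs"

definition lip1 :: "('v \<Rightarrow> real) \<Rightarrow> bool" where
  "lip1 \<phi> \<longleftrightarrow> (\<forall>u \<in> V. \<forall>v \<in> V. \<bar>\<phi> u - \<phi> v\<bar> \<le> real (d u v))"

lemma edge_path_append:
  "edge_path u (p @ q) \<longleftrightarrow> edge_path u p \<and> edge_path (last (u # p)) q"
  by (induction p arbitrary: u) auto

lemma line_int_append:
  "line_int \<psi> \<phi> u (p @ q) = line_int \<psi> \<phi> u p + line_int \<psi> \<phi> (last (u # p)) q"
  by (induction p arbitrary: u) auto

lemma line_int_eq_0: "(\<And>w. w \<in> set (u # p) \<Longrightarrow> \<psi> w = 0) \<Longrightarrow> line_int \<psi> \<phi> u p = 0"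
  by (induction p arbitrary: u) auto

lemma edge_path_geod:
  "geod \<gamma> n \<Longrightarrow> i + k \<le> n \<Longrightarrow> edge_path (\<gamma> i) (map \<gamma> [Suc i..<Suc (i + k)])"
proof (induction k arbitrary: i)
  case (Suc k)
  have "[Suc i..<Suc (i + Suc k)] = Suc i # [Suc (Suc i)..<Suc (Suc i + k)]"
    by (subst upt_conv_Cons) auto
  then show ?case using Suc.prems Suc.IH[of "Suc i"] by (simp add: geod_in geod_dist)
qed simp

lemma last_geod: "last (\<gamma> i # map \<gamma> [Suc i..<Suc (i + k)]) = \<gamma> (i + k)"
  by (cases k) auto

lemma line_int_geod:
  "line_int \<psi> \<phi> (\<gamma> i) (map \<gamma> [Suc i..<Suc (i + k)]) =
     (\<Sum>j<k. \<psi> (\<gamma> (i + j)) * (\<phi> (\<gamma> (Suc (i + j))) - \<phi> (\<gamma> (i + j))))"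
proof (induction k)
  case (Suc k)
  have "[Suc i..<Suc (i + Suc k)] = [Suc i..<Suc (i + k)] @ [Suc (i + k)]" by simp
  then show ?case using Suc last_geod[of \<gamma> i k] by (simp only: map_append line_int_append) simp
qed simp

text \<open>Paths outside the open ball of radius \<open>D\<close> about \<open>a\<close>. The bump
  function of that radius vanishes on them, so they close up a loop without contributing to its
  integral, and only their length matters.\<close>

definition joined_off :: "'v \<Rightarrow> nat \<Rightarrow> 'v \<Rightarrow> 'v \<Rightarrow> nat \<Rightarrow> bool" where
  "joined_off a D u v n \<longleftrightarrow> u \<in> V \<and>
     (\<exists>p. edge_path u p \<and> last (u # p) = v \<and> length p \<le> n \<and> (\<forall>w \<in> set (u # p). D \<le> d a w))"

lemma joined_off_trans:
  assumes "joined_off a D u v m" "joined_off a D v w n"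
  shows "joined_off a D u w (m + n)"
proof -
  obtain p where p: "edge_path u p" "last (u # p) = v" "length p \<le> m" "\<forall>w \<in> set (u # p). D \<le> d a w"
    using assms(1) by (auto simp: joined_off_def)
  obtain q where q: "edge_path v q" "last (v # q) = w" "length q \<le> n" "\<forall>w \<in> set (v # q). D \<le> d a w"
    using assms(2) by (auto simp: joined_off_def)
  have "last (u # p @ q) = w" using p(2) q(2) by (cases q) auto
  then have "edge_path u (p @ q) \<and> last (u # p @ q) = w \<and> length (p @ q) \<le> m + n \<and>
      (\<forall>w \<in> set (u # p @ q). D \<le> d a w)"
    using p q by (auto simp: edge_path_append)
  then show ?thesis using assms(1) unfolding joined_off_def by blast
qed

lemma joined_off_mono: "joined_off a D u v m \<Longrightarrow> m \<le> n \<Longrightarrow> joined_off a D u v n"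
  unfolding joined_off_def using le_trans by blast

lemma joined_off_sym:
  assumes "joined_off a D u v n"
  shows "joined_off a D v u n"
proof -
  have "joined_off a D (last (u # p)) u (length p)"
    if "u \<in> V" "edge_path u p" "\<forall>w \<in> set (u # p). D \<le> d a w" for p u
    using that
  proof (induction p arbitrary: u)
    case Nil
    then show ?case by (auto simp: joined_off_def intro!: exI[of _ "[]"])
  next
    case (Cons w p)
    have "joined_off a D (last (w # p)) w (length p)" using Cons by auto
    moreover have "joined_off a D w u 1"
      using Cons.prems dist_sym[of u w] by (auto simp: joined_off_def intro!: exI[of _ "[u]"])
    ultimately show ?case using joined_off_trans by fastforce
  qed
  then show ?thesis using assms joined_off_mono unfolding joined_off_def[of a D u v n] by blast
qed

lemma joined_off_geod:
  assumes "geod \<gamma> n" "i \<le> n" "j \<le> n" "\<And>k. k \<le> n \<Longrightarrow> D \<le> d a (\<gamma> k)"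
  shows "joined_off a D (\<gamma> i) (\<gamma> j) (d (\<gamma> i) (\<gamma> j))"
proof -
  have *: "joined_off a D (\<gamma> i) (\<gamma> j) (d (\<gamma> i) (\<gamma> j))" if "i \<le> j" "j \<le> n" for i j
  proof -
    define k where "k = j - i"
    then have k: "j = i + k" using that by simp
    show ?thesis
      unfolding joined_off_def
    proof (intro conjI exI[of _ "map \<gamma> [Suc i..<Suc (i + k)]"])
      show "\<gamma> i \<in> V" using geod_in[OF assms(1)] that by simp
      show "\<forall>w \<in> set (\<gamma> i # map \<gamma> [Suc i..<Suc (i + k)]). D \<le> d a w"
        using that k by (auto intro!: assms(4))
      show "edge_path (\<gamma> i) (map \<gamma> [Suc i..<Suc (i + k)])"
        using edge_path_geod[OF assms(1), of i k] that k by blast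
      show "length (map \<gamma> [Suc i..<Suc (i + k)]) \<le> d (\<gamma> i) (\<gamma> j)"
        using geod_dist[OF assms(1), of i j] that k by simp
      show "last (\<gamma> i # map \<gamma> [Suc i..<Suc (i + k)]) = \<gamma> j"
        unfolding k by (rule last_geod)
    qed
  qed
  show ?thesis
  proof (cases "i \<le> j")
    case False
    then have "joined_off a D (\<gamma> j) (\<gamma> i) (d (\<gamma> i) (\<gamma> j))"
      using *[of j i] assms(2) dist_sym[OF geod_in[OF assms(1,2)] geod_in[OF assms(1,3)]] by simp
    then show ?thesis by (rule joined_off_sym)
  next
    case True
    then show ?thesis using assms(3) by (rule *)
  qed
qed

text \<open>A geodesic from \<open>u\<close> to \<open>v\<close> stays within \<open>d u v\<close>
  of \<open>u\<close>, which is too close to \<open>u\<close> to enter the ball.\<close>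

lemma joined_off_near:
  assumes "u \<in> V" "v \<in> V" "a \<in> V" "d u v + D \<le> d a u"
  shows "joined_off a D u v (d u v)"
proof -
  obtain \<gamma> where g: "geod \<gamma> (d u v)" "\<gamma> 0 = u" "\<gamma> (d u v) = v"
    by (rule geod_between[OF assms(1,2)])
  have "D \<le> d a (\<gamma> k)" if "k \<le> d u v" for k
    using dist_triangle[of a "\<gamma> k" u] dist_sym[of "\<gamma> k" u] geod_dist[OF g(1), of 0 k] geod_in[OF g(1) that]
      assms that g(2) by simp
  then show ?thesis using joined_off_geod[OF g(1), of 0 "d u v" D a] g by simp
qed

text \<open>Stokes' theorem in the form of a linear isoperimetric inequality against test functions:
  the bump function around a vertex of a geodesic detects a quadratic area.\<close>

lemma slim_bound:
  assumes stokes: "\<And>\<psi> \<phi> u p. lip1 \<psi> \<Longrightarrow> lip1 \<phi> \<Longrightarrow> u \<in> V \<Longrightarrow> edge_path u p \<Longrightarrow>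
      last (u # p) = u \<Longrightarrow> line_int \<psi> \<phi> u p \<le> K * real (length p)"
    and \<alpha>: "geod \<alpha> l" and i: "i \<le> l" "i1 \<le> i" "i + D \<le> i2" "i2 \<le> l"
    and j: "joined_off (\<alpha> i) D (\<alpha> i2) (\<alpha> i1) m" and K: "0 \<le> K"
  shows "real D * real D \<le> 2 * K * real (i2 - i1 + m)"
proof -
  \<comment> \<open>Truncated subtraction makes the bump zero outside the ball. Since \<phi> grows
    by one at each step of \<alpha>, integrating along \<alpha> just sums the values of the
    bump.\<close>
  define \<psi> where "\<psi> = (\<lambda>v. real (D - d (\<alpha> i) v))"
  define \<phi> where "\<phi> = (\<lambda>v. real (d (\<alpha> 0) v))"
  have V: "\<alpha> k \<in> V" if "k \<le> l" for k using geod_in[OF \<alpha> that] .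
  have lip: "lip1 \<phi>" "lip1 \<psi>"
  proof -
    have *: "d w u \<le> d w v + d u v" "d w v \<le> d w u + d u v" if "u \<in> V" "v \<in> V" "w \<in> V" for u v w
      using dist_triangle[of w u v] dist_triangle[of w v u] dist_sym[of u v] that by auto
    show "lip1 \<phi>" unfolding lip1_def
    proof (intro ballI)
      fix u v assume "u \<in> V" "v \<in> V"
      then show "\<bar>\<phi> u - \<phi> v\<bar> \<le> real (d u v)"
        unfolding \<phi>_def using *[of u v "\<alpha> 0"] V[of 0] by linarith
    qed
    show "lip1 \<psi>" unfolding lip1_def
    proof (intro ballI)
      fix u v assume "u \<in> V" "v \<in> V"
      then show "\<bar>\<psi> u - \<psi> v\<bar> \<le> real (d u v)"
        unfolding \<psi>_def using *[of u v "\<alpha> i"] V[OF i(1)] by linarith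
    qed
  qed
  obtain q where q: "edge_path (\<alpha> i2) q" "last (\<alpha> i2 # q) = \<alpha> i1" "length q \<le> m"
      "\<forall>w \<in> set (\<alpha> i2 # q). D \<le> d (\<alpha> i) w"
    using j by (auto simp: joined_off_def)
  define k where "k = i2 - i1"
  have i2: "i2 = i1 + k" using i by (simp add: k_def)
  define p where "p = map \<alpha> [Suc i1..<Suc (i1 + k)]"
  have lp: "last (\<alpha> i1 # p) = \<alpha> i2" unfolding p_def i2 by (rule last_geod)
  have "line_int \<psi> \<phi> (\<alpha> i1) (p @ q) \<le> K * real (length (p @ q))"
  proof (rule stokes[OF lip(2,1)])
    have "edge_path (\<alpha> i1) p"
      unfolding p_def using edge_path_geod[OF \<alpha>, of i1 k] i i2 by simp
    then show "edge_path (\<alpha> i1) (p @ q)" using q lp unfolding edge_path_append by simp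
    show "last (\<alpha> i1 # p @ q) = \<alpha> i1" using lp q(2) by (cases q) auto
  qed (use V i in auto)
  moreover have "line_int \<psi> \<phi> (\<alpha> i2) q = 0"
    using q(4) by (intro line_int_eq_0) (auto simp: \<psi>_def)
  moreover have "length p = k" by (simp add: p_def)
  ultimately have "line_int \<psi> \<phi> (\<alpha> i1) p \<le> K * (real k + real (length q))"
    using lp by (simp only: line_int_append length_append) simp
  also have "\<dots> \<le> K * (real k + real m)" using K q(3) by (intro mult_left_mono) auto
  finally have up: "line_int \<psi> \<phi> (\<alpha> i1) p \<le> K * (real k + real m)" .
  have "\<phi> (\<alpha> (Suc (i1 + j))) - \<phi> (\<alpha> (i1 + j)) = 1" if "j < k" for j
    using that i i2 by (simp add: \<phi>_def geod_dist[OF \<alpha>])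
  then have eq: "line_int \<psi> \<phi> (\<alpha> i1) p = (\<Sum>j<k. \<psi> (\<alpha> (i1 + j)))"
    unfolding p_def line_int_geod by (intro sum.cong) auto
  \<comment> \<open>Only the half of the bump after \<open>\<alpha> i\<close> is sure to lie on the
    subpath. It contributes D + (D - 1) + ... + 1, which is at least half of \<open>D * D\<close>;
    hence the factor 2.\<close>
  have "(\<Sum>j<D. real D - real j) = (\<Sum>j\<in>(\<lambda>j. i - i1 + j) ` {..<D}. \<psi> (\<alpha> (i1 + j)))"
    using i by (subst sum.reindex) (auto simp: inj_on_def \<psi>_def geod_dist[OF \<alpha>] intro!: sum.cong)
  also have "\<dots> \<le> (\<Sum>j<k. \<psi> (\<alpha> (i1 + j)))"
    using i i2 by (intro sum_mono2) (auto simp: \<psi>_def)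
  finally have "(\<Sum>j<D. real D - real j) \<le> K * (real k + real m)" using up eq by linarith
  moreover have "2 * (\<Sum>j<n. real D - real j) = real n * (2 * real D - real n + 1)" for n
    by (induction n) (simp_all add: algebra_simps)
  from this[of D] have "real D * real D \<le> 2 * (\<Sum>j<D. real D - real j)" by (simp add: algebra_simps)
  ultimately show ?thesis by (simp add: k_def algebra_simps)
qed

text \<open>If \<open>D\<close> is the least constant for perimeter \<open>N\<close> and is
  positive, then \<open>D - 1\<close> fails, so some vertex \<open>a\<close> of a side keeps
  distance at least \<open>D\<close> from the other two sides. A loop of length at most
  \<open>36 * D\<close> runs along this side through \<open>a\<close> and returns outside the ball
  of radius \<open>D\<close> about \<open>a\<close>; \<open>slim_bound\<close> then gives D * D
  \<le> 72 * K * D.\<close>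

lemma slim_if_stokes:
  assumes stokes: "\<And>\<psi> \<phi> u p. lip1 \<psi> \<Longrightarrow> lip1 \<phi> \<Longrightarrow> u \<in> V \<Longrightarrow> edge_path u p \<Longrightarrow>
      last (u # p) = u \<Longrightarrow> line_int \<psi> \<phi> u p \<le> K * real (length p)"
    and K: "0 \<le> K"
  shows "slim (nat \<lceil>72 * K\<rceil>) N"
proof -
  define D where "D = (LEAST D. slim D N)"
  have "slim N N"
    unfolding slim_def
  proof (intro allI impI)
    fix \<alpha> \<beta> \<gamma> l m n i
    assume a: "geod \<alpha> l" "geod \<beta> m" "\<alpha> l = \<beta> 0" "l + m + n \<le> N" "i \<le> l"
    then have "d (\<alpha> i) (\<beta> 0) \<le> N" using geod_dist[OF a(1), of i l] by simp
    then show "\<exists>b \<in> \<beta> ` {..m} \<union> \<gamma> ` {..n}. d (\<alpha> i) b \<le> N" by blast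
  qed
  then have D: "slim D N" unfolding D_def by (rule LeastI)
  have "real D \<le> 72 * K"
  proof (cases D)
    case (Suc D')
    then have "\<not> slim D' N" using not_less_Least[of D' "\<lambda>D. slim D N"] by (simp add: D_def)
    then obtain \<alpha> \<beta> \<gamma> l m n i where
      t: "geod \<alpha> l" "geod \<beta> m" "geod \<gamma> n" "\<alpha> l = \<beta> 0" "\<beta> m = \<gamma> 0" "\<gamma> n = \<alpha> 0" "l + m + n \<le> N"
      and i: "i \<le> l" and "\<And>b. b \<in> \<beta> ` {..m} \<union> \<gamma> ` {..n} \<Longrightarrow> \<not> d (\<alpha> i) b \<le> D'"
      unfolding slim_def not_all not_imp bex_simps by (elim exE conjE) blast
    then have far: "D \<le> d (\<alpha> i) b" if "b \<in> \<beta> ` {..m} \<union> \<gamma> ` {..n}" for b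
      using that Suc by (meson not_less_eq_eq)
    define a where "a = \<alpha> i"
    have aV: "a \<in> V" using geod_in[OF t(1) i] by (simp add: a_def)
    have sidesV: "b \<in> V" if "b \<in> \<beta> ` {..m} \<union> \<gamma> ` {..n}" for b
      using that geod_in[OF t(2)] geod_in[OF t(3)] by auto
    have "D \<le> d (\<alpha> i) (\<gamma> n)" "D \<le> d (\<alpha> i) (\<beta> 0)" using far by auto
    then have Di: "D \<le> i" "i + D \<le> l"
      using geod_dist'[OF t(1) i, of 0] geod_dist'[OF t(1) i, of l] t(4,6) i by auto
    \<comment> \<open>At distance \<open>2 * D\<close> from \<open>a\<close> along the side,
      \<open>D\<close>-slimness offers a way of length at most \<open>D\<close> to another side, and
      a way that short cannot come closer to \<open>a\<close> than \<open>D\<close>.\<close>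
    have exit: "\<exists>b \<in> \<beta> ` {..m} \<union> \<gamma> ` {..n}. joined_off a D (\<alpha> k) b D \<and> d a b \<le> 3 * D"
      if "k \<le> l" "k + 2 * D = i \<or> k = i + 2 * D" for k
    proof -
      obtain b where b: "b \<in> \<beta> ` {..m} \<union> \<gamma> ` {..n}" "d (\<alpha> k) b \<le> D"
        by (rule slimD[OF D t \<open>k \<le> l\<close>])
      have k: "\<alpha> k \<in> V" "d a (\<alpha> k) = 2 * D"
        using geod_in[OF t(1)] geod_dist'[OF t(1) i, of k] that by (auto simp: a_def)
      have "joined_off a D (\<alpha> k) b (d (\<alpha> k) b)"
        using joined_off_near[OF k(1) sidesV[OF b(1)] aV] k(2) b(2) by simp
      moreover have "d a b \<le> 3 * D"
        using dist_triangle[OF aV k(1) sidesV[OF b(1)]] k(2) b(2) by simp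
      ultimately show ?thesis using b joined_off_mono by blast
    qed
    have refl: "joined_off a D b b D" if "b \<in> \<beta> ` {..m} \<union> \<gamma> ` {..n}" for b
      using far[OF that] sidesV[OF that] by (auto simp: joined_off_def a_def intro!: exI[of _ "[]"])
    \<comment> \<open>If the side ends too early for \<open>exit\<close>, its end serves instead,
      being itself a point of another side.\<close>
    obtain i1 b1 where i1: "i1 \<le> i" "i - i1 \<le> 2 * D"
      and b1: "b1 \<in> \<beta> ` {..m} \<union> \<gamma> ` {..n}" "joined_off a D (\<alpha> i1) b1 D" "d a b1 \<le> 3 * D"
    proof (cases "2 * D \<le> i")
      case True
      have "i - 2 * D \<le> l" using i by simp
      then obtain b where "b \<in> \<beta> ` {..m} \<union> \<gamma> ` {..n}" "joined_off a D (\<alpha> (i - 2 * D)) b D" "d a b \<le> 3 * D"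
        using exit[of "i - 2 * D"] True by auto
      then show ?thesis using True that[of "i - 2 * D" b] by simp
    next
      case False
      have "\<gamma> n \<in> \<beta> ` {..m} \<union> \<gamma> ` {..n}" by simp
      then show ?thesis using False that[of 0 "\<gamma> n"] refl[of "\<gamma> n"] t(6) geod_dist'[OF t(1) i, of 0] by (simp add: a_def)
    qed
    obtain i2 b2 where i2: "i + D \<le> i2" "i2 \<le> l" "i2 - i \<le> 2 * D"
      and b2: "b2 \<in> \<beta> ` {..m} \<union> \<gamma> ` {..n}" "joined_off a D (\<alpha> i2) b2 D" "d a b2 \<le> 3 * D"
    proof (cases "i + 2 * D \<le> l")
      case True
      then obtain b where "b \<in> \<beta> ` {..m} \<union> \<gamma> ` {..n}" "joined_off a D (\<alpha> (i + 2 * D)) b D" "d a b \<le> 3 * D"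
        using exit[of "i + 2 * D"] by auto
      then show ?thesis using True that[of "i + 2 * D" b] by simp
    next
      case False
      have "\<beta> 0 \<in> \<beta> ` {..m} \<union> \<gamma> ` {..n}" by simp
      then show ?thesis using False Di that[of l "\<beta> 0"] refl[of "\<beta> 0"] t(4) geod_dist'[OF t(1) i, of l] i
        by (simp add: a_def)
    qed
    have off\<beta>: "joined_off a D (\<beta> j) (\<beta> k) (d (\<beta> j) (\<beta> k))" if "j \<le> m" "k \<le> m" for j k
      using joined_off_geod[OF t(2) that] far by (simp add: a_def)
    have off\<gamma>: "joined_off a D (\<gamma> j) (\<gamma> k) (d (\<gamma> j) (\<gamma> k))" if "j \<le> n" "k \<le> n" for j k
      using joined_off_geod[OF t(3) that] far by (simp add: a_def)
    have same: "d b b' \<le> 6 * D"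
      if "b \<in> \<beta> ` {..m} \<union> \<gamma> ` {..n}" "b' \<in> \<beta> ` {..m} \<union> \<gamma> ` {..n}" "d a b \<le> 3 * D" "d a b' \<le> 3 * D" for b b'
      using dist_triangle[OF sidesV[OF that(1)] aV sidesV[OF that(2)]] dist_sym[OF aV sidesV[OF that(1)]] that(3,4)
      by linarith
    text \<open>Two points on different sides are joined through their common vertex when it is near, and
      otherwise through a shortcut between the sides provided by slimness.\<close>
    have cross: "joined_off a D (\<gamma> j) (\<beta> k) (30 * D)"
      if jk: "j \<le> n" "k \<le> m" and da: "d a (\<gamma> j) \<le> 3 * D" "d a (\<beta> k) \<le> 3 * D" for j k
    proof -
      have V: "\<gamma> j \<in> V" "\<beta> k \<in> V" using jk geod_in t(2,3) by auto
      have jk6: "d (\<gamma> j) (\<beta> k) \<le> 6 * D" using same da jk by auto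
      show ?thesis
      \<comment> \<open>Up to this threshold the way through the common vertex costs at most
        \<open>11 * D\<close> on \<gamma> and \<open>17 * D\<close> on \<beta>, within the allowed
        \<open>30 * D\<close>.\<close>
      proof (cases "j \<le> 11 * D")
        case True
        have "d (\<gamma> j) (\<gamma> 0) = j" using geod_dist'[OF t(3), of j 0] jk by simp
        moreover have "d (\<beta> m) (\<beta> k) \<le> d (\<gamma> 0) (\<gamma> j) + d (\<gamma> j) (\<beta> k)"
          unfolding t(5) using dist_triangle geod_in[OF t(3)] V by simp
        moreover have "d (\<gamma> 0) (\<gamma> j) = j" using geod_dist[OF t(3), of 0 j] jk by simp
        ultimately have "d (\<gamma> j) (\<gamma> 0) + d (\<beta> m) (\<beta> k) \<le> 30 * D" using True jk6 by linarith
        then show ?thesis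
          using joined_off_trans[OF off\<gamma>[OF jk(1), of 0] off\<beta>[OF _ jk(2), of m, unfolded t(5)]]
            joined_off_mono t(5) by simp
      next
        case False
        \<comment> \<open>Points of \<epsilon> are within \<open>6 * D\<close> of
          \<open>\<gamma> j\<close>, whereas \<open>q\<close> is \<open>11 * D\<close> away from it,
          so a point within \<open>D\<close> of \<open>q\<close> cannot lie on \<epsilon> and must
          lie on \<beta>. Moreover \<open>q\<close> is at least \<open>8 * D\<close> from
          \<open>a\<close>, so the shortcut avoids the ball. The whole way costs 11 * D + D + 18 *
          D.\<close>
        define q where "q = \<gamma> (j - 11 * D)"
        have gs: "geod \<gamma> j" using geod_sub[OF t(3), of 0 j] jk by simp
        have bs: "geod (\<lambda>i. \<beta> (k + i)) (m - k)" using geod_sub[OF t(2), of k "m - k"] jk by simp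
        obtain \<epsilon> where e: "geod \<epsilon> (d (\<gamma> j) (\<beta> k))" "\<epsilon> 0 = \<gamma> j" "\<epsilon> (d (\<gamma> j) (\<beta> k)) = \<beta> k"
          by (rule geod_between[OF V])
        have qV: "q \<in> V" using geod_in[OF gs] by (simp add: q_def)
        have dq: "d q (\<gamma> j) = 11 * D"
          using geod_dist[OF gs, of "j - 11 * D" j] False by (simp add: q_def)
        \<comment> \<open>\<open>D\<close>-slimness is available only up to perimeter
          \<open>N\<close>. The triangle cut off by \<epsilon> satisfies this because \<epsilon> is
          no longer than the way round through \<alpha>, which it replaces.\<close>
        have "d (\<gamma> j) (\<beta> k) \<le> l + (n - j) + k"
        proof -
          have "d (\<gamma> j) (\<beta> k) \<le> d (\<gamma> j) (\<gamma> n) + d (\<gamma> n) (\<beta> k)"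
            "d (\<gamma> n) (\<beta> k) \<le> d (\<alpha> 0) (\<alpha> l) + d (\<beta> 0) (\<beta> k)"
            using dist_triangle[of "\<gamma> j" "\<gamma> n" "\<beta> k"] dist_triangle[of "\<gamma> n" "\<alpha> l" "\<beta> k"]
              V geod_in[OF t(3), of n] geod_in[OF t(1), of l] t(4,6) by simp_all
          moreover have "d (\<gamma> j) (\<gamma> n) = n - j" "d (\<alpha> 0) (\<alpha> l) = l" "d (\<beta> 0) (\<beta> k) = k"
            using geod_dist[OF t(3), of j n] geod_dist[OF t(1), of 0 l] geod_dist[OF t(2), of 0 k] jk by simp_all
          ultimately show ?thesis by linarith
        qed
        then have per: "j + d (\<gamma> j) (\<beta> k) + (m - k) \<le> N" using t(7) jk by linarith
        obtain w where w: "w \<in> \<epsilon> ` {..d (\<gamma> j) (\<beta> k)} \<union> (\<lambda>i. \<beta> (k + i)) ` {..m - k}" "d q w \<le> D"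
          unfolding q_def
          by (rule slimD[OF D gs e(1) bs _ _ _ per, of "j - 11 * D"]) (use e jk t(5) in auto)
        have "w \<notin> \<epsilon> ` {..d (\<gamma> j) (\<beta> k)}"
        proof
          assume "w \<in> \<epsilon> ` {..d (\<gamma> j) (\<beta> k)}"
          then obtain r where r: "r \<le> d (\<gamma> j) (\<beta> k)" "w = \<epsilon> r" by auto
          have "d (\<epsilon> r) (\<gamma> j) \<le> 6 * D" using geod_dist'[OF e(1) r(1), of 0] e r jk6 by simp
          then show False
            using dist_triangle[of q w "\<gamma> j"] geod_in[OF e(1) r(1)] qV V r w(2) dq Suc by simp
        qed
        then obtain i where "i \<le> m - k" "w = \<beta> (k + i)" using w(1) by auto
        then obtain r where r: "r \<le> m" "w = \<beta> r" using jk that[of "k + i"] by simp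
        have wV: "w \<in> V" using r geod_in t(2) by simp
        have "d q a \<ge> 8 * D"
          using dist_triangle[of q a "\<gamma> j"] qV aV V dq da by simp
        then have "joined_off a D q w (d q w)"
          using joined_off_near[OF qV wV aV] w(2) dist_sym[OF qV aV] by simp
        moreover have "joined_off a D (\<gamma> j) q (11 * D)"
          using off\<gamma>[of j "j - 11 * D"] jk dq dist_sym[OF qV V(1)] by (simp add: q_def)
        moreover have "joined_off a D w (\<beta> k) (18 * D)"
        proof -
          have "d w (\<beta> k) \<le> 18 * D"
            using dist_triangle[of w q "\<beta> k"] dist_triangle[of q "\<gamma> j" "\<beta> k"] dist_sym[OF qV wV]
              qV wV V dq jk6 w(2) by simp
          then show ?thesis using off\<beta>[OF r(1) jk(2)] joined_off_mono r by simp
        qed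
        ultimately have "joined_off a D (\<gamma> j) (\<beta> k) (11 * D + d q w + 18 * D)"
          using joined_off_trans by blast
        then show ?thesis by (rule joined_off_mono) (use w(2) in simp)
      qed
    qed
    have "joined_off a D b2 b1 (30 * D)"
    proof -
      consider j k where "j \<le> m" "k \<le> m" "b2 = \<beta> j" "b1 = \<beta> k" | j k where "j \<le> n" "k \<le> n" "b2 = \<gamma> j" "b1 = \<gamma> k"
        | j k where "j \<le> n" "k \<le> m" "b2 = \<gamma> j" "b1 = \<beta> k" | j k where "j \<le> n" "k \<le> m" "b1 = \<gamma> j" "b2 = \<beta> k"
        using b1(1) b2(1) by auto
      then show ?thesis
      proof cases
        case 1
        then show ?thesis
          using joined_off_mono[OF off\<beta>[OF 1(1,2)], of "30 * D"] same[OF b2(1) b1(1) b2(3) b1(3)] by simp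
      next
        case 2
        then show ?thesis
          using joined_off_mono[OF off\<gamma>[OF 2(1,2)], of "30 * D"] same[OF b2(1) b1(1) b2(3) b1(3)] by simp
      next
        case 3
        then show ?thesis using cross b1 b2 by simp
      next
        case 4
        then show ?thesis using cross b1 b2 joined_off_sym by simp
      qed
    qed
    then have "joined_off a D (\<alpha> i2) (\<alpha> i1) (D + 30 * D + D)"
      using joined_off_trans[OF joined_off_trans[OF b2(2)] joined_off_sym[OF b1(2)]] by blast
    then have "real D * real D \<le> 2 * K * real (i2 - i1 + (D + 30 * D + D))"
      unfolding a_def by (intro slim_bound[OF stokes t(1) i i1(1) i2(1,2) _ K])
    \<comment> \<open>At most \<open>4 * D\<close> along the side, two exits of length
      \<open>D\<close>, and \<open>30 * D\<close> for the return.\<close>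
    also have "\<dots> \<le> 2 * K * real (36 * D)"
      using K i1 i2 by (intro mult_left_mono) auto
    finally have "real D * real D \<le> (72 * K) * real D" by simp
    then show ?thesis using Suc by simp
  qed (use K in simp)
  then have "D \<le> nat \<lceil>72 * K\<rceil>" by linarith
  then show ?thesis using D by (rule slim_mono[rotated])
qed

end

section \<open>Products of conjugates\<close>

context group
begin

text \<open>By the rule \<open>Suc\<close> the counter is only an upper bound, so estimates can be
  combined without exact counts; \<open>filling_list\<close> turns a filling back into the explicit
  product of the isoperimetric inequality.\<close>

inductive filling :: "'a set \<Rightarrow> nat \<Rightarrow> 'a \<Rightarrow> bool" for R where
  one: "filling R 0 \<one>"
| step: "filling R n u \<Longrightarrow> f \<in> carrier G \<Longrightarrow> r \<in> R \<union> m_inv G ` R \<Longrightarrow>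
    filling R (Suc n) (inv f \<otimes> r \<otimes> f \<otimes> u)"
| Suc: "filling R n u \<Longrightarrow> filling R (Suc n) u"

lemma filling_closed: "filling R n u \<Longrightarrow> R \<subseteq> carrier G \<Longrightarrow> u \<in> carrier G"
  by (induction rule: filling.induct) auto

lemma filling_mono: "filling R n u \<Longrightarrow> filling R (n + k) u"
  by (induction k) (auto intro: filling.Suc)

lemma filling_le: "filling R n u \<Longrightarrow> n \<le> m \<Longrightarrow> filling R m u"
  using filling_mono[of R n u "m - n"] by simp

lemma filling_mult:
  assumes "filling R m u" "filling R n v" "R \<subseteq> carrier G"
  shows "filling R (m + n) (u \<otimes> v)"
  using assms(1)
proof (induction rule: filling.induct)
  case one
  then show ?case using assms by (simp add: filling_closed)
next
  case (step k w f r)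
  have "r \<in> carrier G" using step assms(3) by auto
  then have "inv f \<otimes> r \<otimes> f \<otimes> w \<otimes> v = inv f \<otimes> r \<otimes> f \<otimes> (w \<otimes> v)"
    using step filling_closed assms by (simp add: m_assoc)
  then show ?case using filling.step[OF step.IH step.hyps(2,3)] by simp
next
  case (Suc n u)
  then show ?case by (simp add: filling.Suc)
qed

text \<open>Every conjugator \<open>f\<close> is replaced by \<open>f \<otimes> g\<close>.\<close>

lemma filling_conj:
  assumes "filling R n u" "g \<in> carrier G" "R \<subseteq> carrier G"
  shows "filling R n (inv g \<otimes> u \<otimes> g)"
  using assms(1)
proof (induction rule: filling.induct)
  case one
  then show ?case using assms filling.one by simp
next
  case (step n u f r)
  have c: "r \<in> carrier G" "u \<in> carrier G" using step filling_closed assms(3) by auto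
  have "g \<otimes> (inv g \<otimes> (u \<otimes> g)) = u \<otimes> g"
    using c assms(2) by (simp add: m_assoc[symmetric])
  then have "inv (f \<otimes> g) \<otimes> r \<otimes> (f \<otimes> g) \<otimes> (inv g \<otimes> u \<otimes> g) =
      inv g \<otimes> (inv f \<otimes> r \<otimes> f \<otimes> u) \<otimes> g"
    using c step.hyps(2) assms(2) by (simp add: m_assoc inv_mult_group)
  then show ?case
    using filling.step[OF step.IH, of "f \<otimes> g" r] step.hyps assms(2) by simp
next
  case (Suc n u)
  then show ?case by (simp add: filling.Suc)
qed

lemma filling_conj':
  assumes "filling R n u" "g \<in> carrier G" "R \<subseteq> carrier G"
  shows "filling R n (g \<otimes> u \<otimes> inv g)"
  using filling_conj[OF assms(1), of "inv g"] assms by simp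

text \<open>This permits a loop to be cyclically permuted before it is filled.\<close>

lemma filling_conj_iff:
  assumes "filling R n (inv g \<otimes> u \<otimes> g)" "g \<in> carrier G" "u \<in> carrier G" "R \<subseteq> carrier G"
  shows "filling R n u"
proof -
  have "g \<otimes> (inv g \<otimes> u \<otimes> g) \<otimes> inv g = u"
    using assms by (simp add: m_assoc[symmetric]) (simp add: m_assoc)
  then show ?thesis using filling_conj'[OF assms(1,2,4)] by simp
qed

lemma filling_generator: "r \<in> R \<Longrightarrow> R \<subseteq> carrier G \<Longrightarrow> filling R 1 r"
  using filling.step[OF filling.one, of \<one> r R] by auto

lemma filling_inv:
  assumes "filling R n u" "R \<subseteq> carrier G"
  shows "filling R n (inv u)"
  using assms(1)
proof (induction rule: filling.induct)
  case one
  then show ?case using filling.one by simp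
next
  case (step n u f r)
  have c: "r \<in> carrier G" "u \<in> carrier G" using step filling_closed assms(2) by auto
  have "inv r \<in> R \<union> m_inv G ` R" using step.hyps(3) assms(2) by auto
  then have "filling R 1 (inv f \<otimes> inv r \<otimes> f)"
    using filling.step[OF filling.one, of f "inv r" R] step.hyps(2) c by simp
  then have "filling R (n + 1) (inv u \<otimes> (inv f \<otimes> inv r \<otimes> f))"
    using filling_mult step.IH assms(2) by blast
  also have "inv u \<otimes> (inv f \<otimes> inv r \<otimes> f) = inv (inv f \<otimes> r \<otimes> f \<otimes> u)"
    using c step.hyps(2) by (simp add: inv_mult_group m_assoc)
  finally show ?case by simp
next
  case (Suc n u)
  then show ?case by (simp add: filling.Suc)
qed

text \<open>Used to compose Dehn's algorithm, whose relators are all short loops, with the filling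
  of each short loop over a finite set.\<close>

lemma filling_trans:
  assumes "filling S n u" "\<And>s. s \<in> S \<Longrightarrow> filling R k s" "R \<subseteq> carrier G"
  shows "filling R (n * k) u"
  using assms(1)
proof (induction rule: filling.induct)
  case one
  then show ?case using filling.one by simp
next
  case (step n u f r)
  have "filling R k r" using step.hyps(3) assms(2,3) filling_inv by auto
  then show ?case
    using filling_mult[OF filling_conj[OF _ step.hyps(2) assms(3)] step.IH assms(3)] by simp
next
  case (Suc n u)
  then show ?case using filling_mono[of R "n * k" u k] by (simp add: add.commute)
qed

lemma filling_in_normal:
  assumes "filling R n u" "N \<lhd> G" "R \<subseteq> N"
  shows "u \<in> N"
proof -
  interpret N: normal N G by fact
  show ?thesis using assms(1)
  proof (induction rule: filling.induct)
    case (step n u f r)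
    have "r \<in> N" using step.hyps(3) assms(3) by auto
    then show ?case using step N.inv_op_closed1 by auto
  qed auto
qed

lemma filling_list:
  assumes "filling R n u"
  shows "\<exists>frs. set frs \<subseteq> carrier G \<times> (R \<union> m_inv G ` R) \<and>
      u = foldr (\<otimes>) (map (\<lambda>(f, r). inv f \<otimes> r \<otimes> f) frs) \<one> \<and> length frs \<le> n"
  using assms
proof (induction rule: filling.induct)
  case one
  then show ?case by (auto intro!: exI[of _ "[]"])
next
  case (step n u f r)
  then obtain frs where "set frs \<subseteq> carrier G \<times> (R \<union> m_inv G ` R)"
      "u = foldr (\<otimes>) (map (\<lambda>(f, r). inv f \<otimes> r \<otimes> f) frs) \<one>" "length frs \<le> n" by blast
  then show ?case using step.hyps by (intro exI[of _ "(f, r) # frs"]) auto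
next
  case (Suc n u)
  then show ?case using le_SucI by blast
qed

lemma normal_closureI_filling:
  assumes "N \<lhd> G" "R \<subseteq> N" "\<And>u. u \<in> N \<Longrightarrow> \<exists>n. filling R n u"
  shows "normal_closure G R = N"
  unfolding normal_closure_def using assms filling_in_normal by blast

end

section \<open>Words and cochains over a relative generating set\<close>

text \<open>Finiteness and symmetry of \<open>X\<close> stay outside the locale, which is
  instantiated both with the generating set of an embedding and with that of a relative
  presentation.\<close>

locale rel_generated = group G + H: subgroup H G for G (structure) and H +
  fixes X
  assumes gens: "generates_over G H X"
begin

abbreviation F where "F \<equiv> free_prod G H X"
abbreviation words where "words \<equiv> rel_words H X"
abbreviation cls where "cls \<equiv> word_class G H X"
abbreviation lval where "lval \<equiv> rel_letter_val G"
abbreviation val where "val \<equiv> word_val G"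

lemma X_carrier: "X \<subseteq> carrier G"
  using gens by (simp add: generates_over_def)

sublocale F: group F
  by (rule group_free_prod) (rule group_axioms, rule H.subgroup_axioms)

lemmas lval_closed = rel_letter_val_closed[OF group_axioms H.subgroup_axioms X_carrier]
lemmas val_closed [simp] = word_val_closed[OF group_axioms H.subgroup_axioms X_carrier]
lemmas val_append [simp] = word_val_append[OF group_axioms H.subgroup_axioms X_carrier]
lemmas epi_cls [simp] = natural_epi_word_class[OF group_axioms H.subgroup_axioms X_carrier]

lemma words_simps [simp]:
  "[] \<in> words" "l # w \<in> words \<longleftrightarrow> l \<in> (X \<times> UNIV) <+> H \<and> w \<in> words"
  "u @ v \<in> words \<longleftrightarrow> u \<in> words \<and> v \<in> words"
  by (auto simp: rel_words_def)

lemma letter_simps [simp]: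
  "Inl xb \<in> (X \<times> UNIV) <+> H \<longleftrightarrow> fst xb \<in> X" "Inr h \<in> (X \<times> UNIV) <+> H \<longleftrightarrow> h \<in> H"
  by (auto simp: mem_Times_iff)

lemma words_take_drop: "w \<in> words \<Longrightarrow> take n w \<in> words \<and> drop n w \<in> words"
  by (auto simp: rel_words_def dest: in_set_takeD in_set_dropD)

lemma words_rev_map: "w \<in> words \<Longrightarrow> (\<And>l. l \<in> (X \<times> UNIV) <+> H \<Longrightarrow> f l \<in> (X \<times> UNIV) <+> H) \<Longrightarrow>
    rev (map f w) \<in> words"
  by (auto simp: rel_words_def)

lemma val_simps [simp]: "val [] = \<one>" "val (l # w) = lval l \<otimes> val w"
  by (simp_all add: word_val_def)

lemma F_carrier: "carrier F = cls ` words"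
  by (rule carrier_free_prod)

lemma cls_closed [simp]: "w \<in> words \<Longrightarrow> cls w \<in> carrier F"
  by (simp add: F_carrier)

lemma cls_append: "u \<in> words \<Longrightarrow> v \<in> words \<Longrightarrow> cls (u @ v) = cls u \<otimes>\<^bsub>F\<^esub> cls v"
  by (simp add: word_class_mult)

lemma cls_Cons: "l \<in> (X \<times> UNIV) <+> H \<Longrightarrow> w \<in> words \<Longrightarrow> cls (l # w) = cls [l] \<otimes>\<^bsub>F\<^esub> cls w"
  using cls_append[of "[l]" w] by simp

lemma cls_Nil: "cls [] = \<one>\<^bsub>F\<^esub>"
  by (simp add: free_prod_def)

lemma cls_mult: "h \<in> H \<Longrightarrow> h' \<in> H \<Longrightarrow> cls [Inr h, Inr h'] = cls [Inr (h \<otimes> h')]"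
  using word_reduction.mult[of "[]" H X "[]" h h' G]
  by (intro word_class_eqI) auto

lemma cls_one: "cls [Inr \<one>] = \<one>\<^bsub>F\<^esub>"
  using word_class_eqI[OF word_reduction.one[of "[]" H X "[]" G]] cls_Nil by simp

lemma word_of: "g \<in> carrier G \<Longrightarrow> \<exists>w \<in> words. val w = g"
proof -
  assume "g \<in> carrier G"
  then have "g \<in> natural_epi G ` carrier F"
    using natural_epi_surj[OF group_axioms H.subgroup_axioms X_carrier gens] by simp
  then show ?thesis by (auto simp: F_carrier)
qed

definition letter_inv :: "'a \<times> bool + 'a \<Rightarrow> 'a \<times> bool + 'a" where
  "letter_inv l = (case l of Inl (x, b) \<Rightarrow> Inl (x, \<not> b) | Inr h \<Rightarrow> Inr (inv h))"

definition winv :: "'a rel_word \<Rightarrow> 'a rel_word" where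
  "winv w = rev (map letter_inv w)"

lemma letter_inv_closed [simp]: "l \<in> (X \<times> UNIV) <+> H \<Longrightarrow> letter_inv l \<in> (X \<times> UNIV) <+> H"
  by (auto simp: letter_inv_def)

lemma lval_letter_inv: "l \<in> (X \<times> UNIV) <+> H \<Longrightarrow> lval (letter_inv l) = inv (lval l)"
  using X_carrier by (auto simp: letter_inv_def)

lemma winv_closed [simp]: "w \<in> words \<Longrightarrow> winv w \<in> words"
  unfolding winv_def by (rule words_rev_map) auto

lemma winv_simps [simp]: "winv [] = []" "winv (l # w) = winv w @ [letter_inv l]"
  "length (winv w) = length w"
  by (simp_all add: winv_def)

lemma val_winv [simp]: "w \<in> words \<Longrightarrow> val (winv w) = inv (val w)"
  by (induction w) (simp_all add: lval_letter_inv lval_closed inv_mult_group)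

lemma cls_letter_inv:
  assumes "l \<in> (X \<times> UNIV) <+> H"
  shows "cls [letter_inv l] = inv\<^bsub>F\<^esub> cls [l]"
proof -
  have "cls [letter_inv l, l] = \<one>\<^bsub>F\<^esub>"
  proof (cases l)
    case (Inl xb)
    then obtain x b where l: "l = Inl (x, b)" "x \<in> X" using assms by (cases xb) auto
    then show ?thesis
      using word_class_eqI[OF word_reduction.cancel[of "[]" H X "[]" x G "\<not> b"]]
      by (simp add: letter_inv_def cls_Nil)
  next
    case (Inr h)
    then have "h \<in> H" using assms by auto
    then show ?thesis using Inr cls_mult[of "inv h" h] by (simp add: letter_inv_def cls_one)
  qed
  then have "cls [letter_inv l] \<otimes>\<^bsub>F\<^esub> cls [l] = \<one>\<^bsub>F\<^esub>"
    using assms cls_append[of "[letter_inv l]" "[l]"] by simp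
  then show ?thesis
    by (rule F.inv_equality[symmetric]) (use assms in simp_all)
qed

lemma cls_winv: "w \<in> words \<Longrightarrow> cls (winv w) = inv\<^bsub>F\<^esub> cls w"
proof (induction w)
  case Nil
  then show ?case by (simp add: cls_Nil)
next
  case (Cons l w)
  then have "cls (l # w) = cls [l] \<otimes>\<^bsub>F\<^esub> cls w" by (intro cls_Cons) auto
  then show ?case using Cons by (simp add: cls_append cls_letter_inv F.inv_mult_group)
qed

section \<open>Integration of cochains along words\<close>

primrec word_int :: "('a \<Rightarrow> 'a \<times> bool + 'a \<Rightarrow> real) \<Rightarrow> 'a \<Rightarrow> 'a rel_word \<Rightarrow> real" where
  "word_int f g [] = 0"
| "word_int f g (l # w) = f g l + word_int f (g \<otimes> lval l) w"

text \<open>Cochains on the Cayley graph that vanish on the triangles with labels in \<open>H\<close>.\<close>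

definition cochain :: "('a \<Rightarrow> 'a \<times> bool + 'a \<Rightarrow> real) \<Rightarrow> bool" where
  "cochain f \<longleftrightarrow>
     (\<forall>g \<in> carrier G. \<forall>x \<in> X. \<forall>b. f g (Inl (x, b)) + f (g \<otimes> lval (Inl (x, b))) (Inl (x, \<not> b)) = 0) \<and>
     (\<forall>g \<in> carrier G. \<forall>h \<in> H. \<forall>h' \<in> H. f g (Inr h) + f (g \<otimes> h) (Inr h') = f g (Inr (h \<otimes> h')))"

lemma cochain_one: "cochain f \<Longrightarrow> g \<in> carrier G \<Longrightarrow> f g (Inr \<one>) = 0"
proof -
  assume f: "cochain f" and g: "g \<in> carrier G"
  have "f g (Inr \<one>) + f (g \<otimes> \<one>) (Inr \<one>) = f g (Inr (\<one> \<otimes> \<one>))"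
    using f g H.one_closed unfolding cochain_def by blast
  then show ?thesis using g by simp
qed

lemma cochain_letter_inv:
  assumes "cochain f" "g \<in> carrier G" "l \<in> (X \<times> UNIV) <+> H"
  shows "f (g \<otimes> lval l) (letter_inv l) = - f g l"
proof (cases l)
  case (Inl xb)
  then obtain x b where l: "l = Inl (x, b)" "x \<in> X" using assms(3) by (cases xb) auto
  then have "f g (Inl (x, b)) + f (g \<otimes> lval (Inl (x, b))) (Inl (x, \<not> b)) = 0"
    using assms(1,2) unfolding cochain_def by blast
  then show ?thesis using l by (simp add: letter_inv_def)
next
  case (Inr h)
  then have h: "h \<in> H" using assms by auto
  then have "f g (Inr h) + f (g \<otimes> h) (Inr (inv h)) = f g (Inr \<one>)"
  proof -
    have "f g (Inr h) + f (g \<otimes> h) (Inr (inv h)) = f g (Inr (h \<otimes> inv h))"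
      using assms(1,2) h H.m_inv_closed unfolding cochain_def by blast
    then show ?thesis using h by simp
  qed
  then show ?thesis using Inr cochain_one[OF assms(1,2)] by (simp add: letter_inv_def)
qed

lemma word_int_append [simp]:
  "u \<in> words \<Longrightarrow> g \<in> carrier G \<Longrightarrow>
     word_int f g (u @ v) = word_int f g u + word_int f (g \<otimes> val u) v"
  by (induction u arbitrary: g) (simp_all add: lval_closed m_assoc)

lemma word_int_winv:
  assumes "cochain f"
  shows "w \<in> words \<Longrightarrow> g \<in> carrier G \<Longrightarrow> word_int f (g \<otimes> val w) (winv w) = - word_int f g w"
proof (induction w arbitrary: g)
  case (Cons l w)
  have "g \<otimes> (lval l \<otimes> val w) = g \<otimes> lval l \<otimes> val w" using Cons.prems by (simp add: m_assoc lval_closed)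
  moreover have "g \<otimes> lval l \<otimes> val w \<otimes> inv (val w) = g \<otimes> lval l"
    using Cons.prems by (simp add: m_assoc lval_closed)
  ultimately show ?case
    using Cons cochain_letter_inv[OF assms] by (simp add: lval_closed)
qed simp

text \<open>The two conditions on a cochain are invariance under \<open>cancel\<close> and under
  \<open>mult\<close>; invariance under \<open>one\<close> follows from the second. Hence the
  integral depends only on the class of the word in \<open>H * F(X)\<close>.\<close>

lemma word_int_reduction:
  assumes f: "cochain f" and g: "g \<in> carrier G" and "word_reduction G H X u v"
  shows "word_int f g u = word_int f g v"
  using assms(3)
proof cases
  case (cancel u' v' x b)
  have x: "x \<in> carrier G" using cancel X_carrier by auto
  have "f k (Inl (x, b)) + f (k \<otimes> lval (Inl (x, b))) (Inl (x, \<not> b)) = 0" if "k \<in> carrier G" for k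
    using f cancel that unfolding cochain_def by blast
  from this[of "g \<otimes> val u'"] show ?thesis using cancel g x
    by (cases b) (simp_all add: m_assoc)
next
  case (mult u' v' h h')
  have "f k (Inr h) + f (k \<otimes> h) (Inr h') = f k (Inr (h \<otimes> h'))" if "k \<in> carrier G" for k
    using f mult that unfolding cochain_def by blast
  from this[of "g \<otimes> val u'"] show ?thesis using mult g by (simp add: m_assoc)
next
  case (one u' v')
  then show ?thesis using g cochain_one[OF f, of "g \<otimes> val u'"] by simp
qed

lemma word_int_cong:
  assumes f: "cochain f" and g: "g \<in> carrier G" and uv: "u \<in> words" "v \<in> words" "cls u = cls v"
  shows "word_int f g u = word_int f g v"
proof -
  have "(u, v) \<in> word_equiv G H X"
    by (rule eq_equiv_class[OF _ equiv_word_equiv uv(2)]) (use uv(3) in \<open>simp add: word_class_def\<close>)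
  then have "equivclp (word_reduction G H X) u v" by (simp add: word_equiv_def)
  then show ?thesis
    by (induction rule: equivclp_induct) (auto dest: word_int_reduction[OF f g])
qed

text \<open>The isoperimetric inequality as seen by pairing fillings with cochains: finitely many
  test loops control all integrals up to a linear factor. Fillings do not occur in it, so it can be
  moved between generating sets. Letting \<open>g\<close> range over the group accounts for all
  translates of the test loops.\<close>

definition dual_linear_isoperimetric :: bool where
  "dual_linear_isoperimetric \<longleftrightarrow>
     (\<exists>S K. finite S \<and> S \<subseteq> {w \<in> words. val w = \<one>} \<and> 0 \<le> K \<and>
        (\<forall>f B. cochain f \<longrightarrow> 0 \<le> B \<longrightarrow> (\<forall>g \<in> carrier G. \<forall>s \<in> S. \<bar>word_int f g s\<bar> \<le> B) \<longrightarrow>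
           (\<forall>g \<in> carrier G. \<forall>w \<in> words. val w = \<one> \<longrightarrow> \<bar>word_int f g w\<bar> \<le> K * B * real (length w))))"

lemma dual_linear_isoperimetricE:
  assumes dual_linear_isoperimetric
  obtains S K where "finite S" "S \<subseteq> {w \<in> words. val w = \<one>}" "0 \<le> K"
    and "\<And>f B g w. cochain f \<Longrightarrow> 0 \<le> B \<Longrightarrow> (\<forall>g \<in> carrier G. \<forall>s \<in> S. \<bar>word_int f g s\<bar> \<le> B) \<Longrightarrow>
      g \<in> carrier G \<Longrightarrow> w \<in> words \<Longrightarrow> val w = \<one> \<Longrightarrow> \<bar>word_int f g w\<bar> \<le> K * B * real (length w)"
proof -
  from assms obtain S K where *: "finite S" "S \<subseteq> {w \<in> words. val w = \<one>}" "0 \<le> K"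
    "\<forall>f B. cochain f \<longrightarrow> 0 \<le> B \<longrightarrow> (\<forall>g \<in> carrier G. \<forall>s \<in> S. \<bar>word_int f g s\<bar> \<le> B) \<longrightarrow>
       (\<forall>g \<in> carrier G. \<forall>w \<in> words. val w = \<one> \<longrightarrow> \<bar>word_int f g w\<bar> \<le> K * B * real (length w))"
    unfolding dual_linear_isoperimetric_def by (elim exE conjE) (rule that)
  show ?thesis by (rule that[OF *(1-3)]) (use *(4) in simp)
qed

text \<open>The arm labelled \<open>a\<close> is traversed in both directions and cancels; only the
  base point of the loop \<open>s\<close> moves.\<close>

lemma word_int_conj:
  assumes "cochain f" "g \<in> carrier G" "a \<in> words" "s \<in> words" "val s = \<one>"
  shows "word_int f g (winv a @ s @ a) = word_int f (g \<otimes> inv (val a)) s"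
  using assms word_int_winv[OF assms(1,3), of "g \<otimes> inv (val a)"] by (simp add: m_assoc)

text \<open>Integrating a cochain over a product of k conjugates of relators gives k integrals over
  translates of relators or their inverses, each at most \<open>B\<close> in absolute value. The
  test loops are words chosen to represent the relators.\<close>

lemma dual_if_linear_rel_isoperimetric:
  assumes R: "finite R" "R \<subseteq> kernel F G (natural_epi G)"
    and iso: "linear_rel_isoperimetric G H X R"
  shows dual_linear_isoperimetric
proof -
  obtain C where C: "\<And>w. w \<in> words \<Longrightarrow> val w = \<one> \<Longrightarrow>
      \<exists>frs. set frs \<subseteq> carrier F \<times> (R \<union> m_inv F ` R) \<and>
        cls w = foldr (\<otimes>\<^bsub>F\<^esub>) (map (\<lambda>(f, r). inv\<^bsub>F\<^esub> f \<otimes>\<^bsub>F\<^esub> r \<otimes>\<^bsub>F\<^esub> f) frs) \<one>\<^bsub>F\<^esub> \<and>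
        real (length frs) \<le> C * real (length w)"
    using iso unfolding linear_rel_isoperimetric_def by blast
  have "\<exists>w \<in> words. cls w = r" if "r \<in> R" for r
    using that R(2) by (auto simp: kernel_def F_carrier)
  then obtain rep where rep: "\<And>r. r \<in> R \<Longrightarrow> rep r \<in> words \<and> cls (rep r) = r" by metis
  have val_rep: "val (rep r) = \<one>" if "r \<in> R" for r
    using that R(2) rep[OF that] epi_cls[of "rep r"] by (auto simp: kernel_def)
  \<comment> \<open>\<open>C\<close> may be negative, whereas the factor in
    \<open>dual_linear_isoperimetric\<close> has to be nonnegative.\<close>
  have "\<bar>word_int f g w\<bar> \<le> max 0 C * B * real (length w)"
    if f: "cochain f" and B: "0 \<le> B" "\<forall>g \<in> carrier G. \<forall>s \<in> rep ` R. \<bar>word_int f g s\<bar> \<le> B"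
      and g: "g \<in> carrier G" and w: "w \<in> words" "val w = \<one>" for f B g w
  proof -
    have fill: "\<exists>w \<in> words. cls w = foldr (\<otimes>\<^bsub>F\<^esub>) (map (\<lambda>(f, r). inv\<^bsub>F\<^esub> f \<otimes>\<^bsub>F\<^esub> r \<otimes>\<^bsub>F\<^esub> f) frs) \<one>\<^bsub>F\<^esub> \<and>
        (\<forall>g \<in> carrier G. \<bar>word_int f g w\<bar> \<le> real (length frs) * B)"
      if "set frs \<subseteq> carrier F \<times> (R \<union> m_inv F ` R)" for frs
      using that
    proof (induction frs)
      case Nil
      then show ?case by (auto simp: cls_Nil intro!: bexI[of _ "[]"])
    next
      case (Cons p frs)
      obtain a r where p: "p = (cls a, r)" "a \<in> words" "r \<in> R \<union> m_inv F ` R"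
        using Cons.prems by (cases p) (auto simp: F_carrier)
      obtain v where v: "v \<in> words"
          "cls v = foldr (\<otimes>\<^bsub>F\<^esub>) (map (\<lambda>(f, r). inv\<^bsub>F\<^esub> f \<otimes>\<^bsub>F\<^esub> r \<otimes>\<^bsub>F\<^esub> f) frs) \<one>\<^bsub>F\<^esub>"
          "\<And>g. g \<in> carrier G \<Longrightarrow> \<bar>word_int f g v\<bar> \<le> real (length frs) * B"
        using Cons by auto
      obtain s where s: "s \<in> words" "val s = \<one>" "cls s = r" "\<And>g. g \<in> carrier G \<Longrightarrow> \<bar>word_int f g s\<bar> \<le> B"
      proof (cases "r \<in> R")
        case True
        then show ?thesis using that[of "rep r"] rep val_rep B(2) by simp
      next
        case False
        then obtain r' where r': "r' \<in> R" "r = inv\<^bsub>F\<^esub> r'" using p by auto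
        have "word_int f g (winv (rep r')) = - word_int f g (rep r')" if "g \<in> carrier G" for g
          using word_int_winv[OF f, of "rep r'" g] rep[OF r'(1)] val_rep[OF r'(1)] that by simp
        then show ?thesis
          using that[of "winv (rep r')"] rep[OF r'(1)] val_rep[OF r'(1)] B(2) r' cls_winv[of "rep r'"] by simp
      qed
      show ?case
      proof (intro bexI[of _ "(winv a @ s @ a) @ v"] conjI ballI)
        show "cls ((winv a @ s @ a) @ v) =
            foldr (\<otimes>\<^bsub>F\<^esub>) (map (\<lambda>(f, r). inv\<^bsub>F\<^esub> f \<otimes>\<^bsub>F\<^esub> r \<otimes>\<^bsub>F\<^esub> f) (p # frs)) \<one>\<^bsub>F\<^esub>"
          using p(1,2) s(1) v(1) by (simp add: v(2)[symmetric] s(3)[symmetric] cls_append cls_winv F.m_assoc)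
        fix g assume g: "g \<in> carrier G"
        have "word_int f g ((winv a @ s @ a) @ v) = word_int f g (winv a @ s @ a) + word_int f g v"
          using word_int_append[of "winv a @ s @ a" g f v] p(2) s g by simp
        also have "\<dots> = word_int f (g \<otimes> inv (val a)) s + word_int f g v"
          using word_int_conj[OF f g p(2) s(1,2)] by (simp only:)
        finally show "\<bar>word_int f g ((winv a @ s @ a) @ v)\<bar> \<le> real (length (p # frs)) * B"
          using s(4)[of "g \<otimes> inv (val a)"] v(3)[OF g] g p(2) by (simp add: algebra_simps)
      qed (use p s v in simp)
    qed
    obtain frs where frs: "set frs \<subseteq> carrier F \<times> (R \<union> m_inv F ` R)"
        "cls w = foldr (\<otimes>\<^bsub>F\<^esub>) (map (\<lambda>(f, r). inv\<^bsub>F\<^esub> f \<otimes>\<^bsub>F\<^esub> r \<otimes>\<^bsub>F\<^esub> f) frs) \<one>\<^bsub>F\<^esub>"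
        "real (length frs) \<le> C * real (length w)"
      using C[OF w] by blast
    obtain v where v: "v \<in> words" "cls v = cls w" "\<bar>word_int f g v\<bar> \<le> real (length frs) * B"
      using fill[OF frs(1)] frs(2) g by auto
    have "real (length frs) * B \<le> (max 0 C * real (length w)) * B"
      using frs(3) by (intro mult_right_mono B(1) order_trans[OF frs(3)]) auto
    then show ?thesis
      using v(3) word_int_cong[OF f g v(1) w(1) v(2)] by (simp add: mult.commute mult.left_commute)
  qed
  then show ?thesis
    unfolding dual_linear_isoperimetric_def
    using R(1) rep val_rep by (intro exI[of _ "rep ` R"] exI[of _ "max 0 C"]) auto
qed

section \<open>Change of the relative generating set\<close>

primrec letter_subst :: "('a \<Rightarrow> 'a rel_word) \<Rightarrow> 'a \<times> bool + 'a \<Rightarrow> 'a rel_word" where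
  "letter_subst v (Inl p) = (if snd p then v (fst p) else winv (v (fst p)))"
| "letter_subst v (Inr h) = [Inr h]"

definition pullback ::
    "('a \<Rightarrow> 'a rel_word) \<Rightarrow> ('a \<Rightarrow> 'a \<times> bool + 'a \<Rightarrow> real) \<Rightarrow> 'a \<Rightarrow> 'a \<times> bool + 'a \<Rightarrow> real" where
  "pullback v f g l = word_int f g (letter_subst v l)"

definition word_subst :: "('a \<Rightarrow> 'a rel_word) \<Rightarrow> 'a rel_word \<Rightarrow> 'a rel_word" where
  "word_subst v w = concat (map (letter_subst v) w)"

context
  fixes Y v
  assumes Y: "rel_generated G H Y" and v: "\<forall>y \<in> Y. v y \<in> words \<and> val (v y) = y"
begin

interpretation Y: rel_generated G H Y by (rule Y)

lemma letter_subst: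
  assumes "l \<in> (Y \<times> UNIV) <+> H"
  shows "letter_subst v l \<in> words \<and> val (letter_subst v l) = lval l"
  using assms v by (cases l) auto

lemma word_subst: "w \<in> Y.words \<Longrightarrow> word_subst v w \<in> words \<and> val (word_subst v w) = val w"
  by (induction w) (simp_all add: word_subst_def letter_subst)

lemma length_word_subst:
  assumes "1 \<le> L" "\<forall>y \<in> Y. length (v y) \<le> L" "w \<in> Y.words"
  shows "length (word_subst v w) \<le> L * length w"
proof -
  have "length (letter_subst v l) \<le> L" if "l \<in> (Y \<times> UNIV) <+> H" for l
    using that assms(1,2) by (cases l) auto
  then show ?thesis using assms(3)
    by (induction w) (simp_all add: word_subst_def add_mono)
qed

lemma word_int_pullback:
  assumes "w \<in> Y.words" "g \<in> carrier G"
  shows "word_int (pullback v f) g w = word_int f g (word_subst v w)"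
  using assms
  by (induction w arbitrary: g) (simp_all add: word_subst_def letter_subst pullback_def Y.lval_closed)

lemma cochain_pullback:
  assumes f: "cochain f"
  shows "Y.cochain (pullback v f)"
  unfolding Y.cochain_def
proof (intro conjI ballI allI)
  fix g y b assume g: "g \<in> carrier G" and y: "y \<in> Y"
  have yc: "y \<in> carrier G" using y Y.X_carrier by auto
  show "pullback v f g (Inl (y, b)) + pullback v f (g \<otimes> lval (Inl (y, b))) (Inl (y, \<not> b)) = 0"
    using word_int_winv[OF f, of "v y"] v y g yc
      word_int_winv[OF f, of "v y" "g \<otimes> inv y"]
    by (cases b) (simp_all add: pullback_def m_assoc)
next
  fix g h h' assume "g \<in> carrier G" "h \<in> H" "h' \<in> H"
  then show "pullback v f g (Inr h) + pullback v f (g \<otimes> h) (Inr h') = pullback v f g (Inr (h \<otimes> h'))"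
    using f unfolding cochain_def pullback_def by simp
qed

end

text \<open>Rewriting a word over \<open>X\<close> in terms of \<open>Y\<close> and back alters the integral of a cochain by a
  bounded amount for each letter.\<close>

lemma dual_linear_isoperimetric_transfer:
  assumes Y: "rel_generated G H Y" and dual: "rel_generated.dual_linear_isoperimetric G H Y"
    and fin: "finite X"
  shows dual_linear_isoperimetric
proof -
  interpret Y: rel_generated G H Y by (rule Y)
  have X: "rel_generated G H X" by unfold_locales
  have "\<forall>y \<in> Y. \<exists>w. w \<in> words \<and> val w = y" using word_of Y.X_carrier by blast
  then obtain v where v: "\<forall>y \<in> Y. v y \<in> words \<and> val (v y) = y" by (rule bchoice[THEN exE])
  have "\<forall>x \<in> X. \<exists>w. w \<in> Y.words \<and> val w = x" using Y.word_of X_carrier by blast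
  then obtain u where u: "\<forall>x \<in> X. u x \<in> Y.words \<and> val (u x) = x" by (rule bchoice[THEN exE])
  obtain S K where S: "finite S" "S \<subseteq> {w \<in> Y.words. val w = \<one>}" and K: "0 \<le> K"
    and dual: "\<And>f B g w. Y.cochain f \<Longrightarrow> 0 \<le> B \<Longrightarrow> (\<forall>g \<in> carrier G. \<forall>s \<in> S. \<bar>word_int f g s\<bar> \<le> B) \<Longrightarrow>
      g \<in> carrier G \<Longrightarrow> w \<in> Y.words \<Longrightarrow> val w = \<one> \<Longrightarrow> \<bar>word_int f g w\<bar> \<le> K * B * real (length w)"
    by (rule Y.dual_linear_isoperimetricE[OF dual]) (rule that; assumption)
  \<comment> \<open>\<open>Suc\<close> ensures 1 \<le> \<open>L\<close>, which covers the letters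
    from \<open>H\<close>, since these are replaced by themselves.\<close>
  define L where "L = Suc (\<Sum>x\<in>X. length (u x))"
  have L: "1 \<le> L" "\<forall>x \<in> X. length (u x) \<le> L"
    using fin by (auto simp: L_def intro!: le_SucI member_le_sum)
  \<comment> \<open>Besides the rewritten test loops, \<open>T\<close> contains for each
    \<open>x\<close> the loop along its double rewriting and back along \<open>x\<close>. These
    loops bound the error made by rewriting a single letter there and back.\<close>
  define T where "T = word_subst v ` S \<union> (\<lambda>x. word_subst v (u x) @ [Inl (x, False)]) ` X"
  note sv = word_subst[OF Y v]
  note su = Y.word_subst[OF X u] Y.length_word_subst[OF X u L]
  \<comment> \<open>\<open>K * real L\<close> comes from the inequality over \<open>Y\<close>,
    applied to a word at most \<open>L\<close> times as long; the summand 1 is the error of at most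
    \<open>B\<close> per letter.\<close>
  have bound: "\<bar>word_int f g w\<bar> \<le> (K * real L + 1) * B * real (length w)"
    if f: "cochain f" and B: "0 \<le> B" "\<forall>g \<in> carrier G. \<forall>s \<in> T. \<bar>word_int f g s\<bar> \<le> B"
      and g: "g \<in> carrier G" and w: "w \<in> words" "val w = \<one>" for f B g w
  proof -
    define f' where "f' = pullback v f"
    have f': "Y.cochain f'" unfolding f'_def by (rule cochain_pullback[OF Y v f])
    have int': "word_int f' g w = word_int f g (word_subst v w)" if "w \<in> Y.words" "g \<in> carrier G" for g w
      unfolding f'_def by (rule word_int_pullback[OF Y v that])
    have letter: "\<bar>word_int f' g (u x) - f g (Inl (x, True))\<bar> \<le> B" if "x \<in> X" "g \<in> carrier G" for x g
    proof -
      have "word_int f g (word_subst v (u x) @ [Inl (x, False)]) =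
          word_int f' g (u x) + f (g \<otimes> x) (Inl (x, False))"
        using sv[of "u x"] u that int' by simp
      moreover have "f (g \<otimes> x) (Inl (x, False)) = - f g (Inl (x, True))"
        using cochain_letter_inv[OF f that(2), of "Inl (x, True)"] that by (simp add: letter_inv_def)
      moreover have "word_subst v (u x) @ [Inl (x, False)] \<in> T" using that by (simp add: T_def)
      then have "\<bar>word_int f g (word_subst v (u x) @ [Inl (x, False)])\<bar> \<le> B" using B(2) that(2) by blast
      ultimately show ?thesis by simp
    qed
    have "\<bar>word_int f' g (word_subst u w) - word_int f g w\<bar> \<le> real (length w) * B"
      if "w \<in> words" "g \<in> carrier G" for w g
      using that
    proof (induction w arbitrary: g)
      case Nil
      then show ?case by (simp add: word_subst_def)
    next
      case (Cons l w)
      have lc: "letter_subst u l \<in> Y.words" "val (letter_subst u l) = lval l"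
        using Y.letter_subst[OF X u, of l] Cons.prems by auto
      have gl: "g \<otimes> lval l \<in> carrier G" using Cons.prems by (simp add: lval_closed)
      have "\<bar>word_int f' g (letter_subst u l) - f g l\<bar> \<le> B"
      proof (cases l)
        case (Inl p)
        then obtain x b where l: "l = Inl (x, b)" "x \<in> X" using Cons.prems by (cases p) auto
        show ?thesis
        proof (cases b)
          case True
          then show ?thesis using l letter Cons.prems by simp
        next
          case False
          have x: "x \<in> carrier G" using l X_carrier by auto
          have "word_int f' g (winv (u x)) = - word_int f' (g \<otimes> inv x) (u x)"
            using Y.word_int_winv[OF f', of "u x" "g \<otimes> inv x"] u l(2) Cons.prems x
            by (simp add: m_assoc)
          moreover have "f g (Inl (x, False)) = - f (g \<otimes> inv x) (Inl (x, True))"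
            using cochain_letter_inv[OF f, of "g \<otimes> inv x" "Inl (x, True)"] Cons.prems x l
            by (simp add: letter_inv_def m_assoc)
          ultimately show ?thesis using letter[OF l(2), of "g \<otimes> inv x"] Cons.prems x False l by simp
        qed
      next
        case (Inr h)
        then show ?thesis using B(1) Cons.prems by (simp add: f'_def pullback_def)
      qed
      moreover have "word_int f' g (word_subst u (l # w)) =
          word_int f' g (letter_subst u l) + word_int f' (g \<otimes> lval l) (word_subst u w)"
        using lc Cons.prems by (simp add: word_subst_def)
      moreover have "\<bar>word_int f' (g \<otimes> lval l) (word_subst u w) - word_int f (g \<otimes> lval l) w\<bar> \<le> real (length w) * B"
        using Cons gl by auto
      ultimately show ?case by (simp add: algebra_simps)
    qed
    from this[OF w(1) g] have "\<bar>word_int f' g (word_subst u w) - word_int f g w\<bar> \<le> real (length w) * B" .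
    moreover have "\<bar>word_int f' g (word_subst u w)\<bar> \<le> K * B * real (length (word_subst u w))"
    proof (rule dual[OF f' B(1) _ g])
      show "\<forall>g \<in> carrier G. \<forall>s \<in> S. \<bar>word_int f' g s\<bar> \<le> B"
      proof (intro ballI)
        fix g s assume gs: "g \<in> carrier G" "s \<in> S"
        then have "word_int f' g s = word_int f g (word_subst v s)" using S(2) int' by blast
        moreover have "word_subst v s \<in> T" using gs by (simp add: T_def)
        ultimately show "\<bar>word_int f' g s\<bar> \<le> B" using B(2) gs(1) by simp
      qed
    qed (use su(1)[OF w(1)] w in auto)
    moreover have "K * B * real (length (word_subst u w)) \<le> K * B * (real L * real (length w))"
      using su(2)[OF w(1)] K B(1) by (intro mult_left_mono) (auto simp: of_nat_mult[symmetric] simp del: of_nat_mult)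
    ultimately have "\<bar>word_int f g w\<bar> \<le> K * B * (real L * real (length w)) + real (length w) * B" by linarith
    then show ?thesis by (simp add: algebra_simps)
  qed
  show ?thesis
    unfolding dual_linear_isoperimetric_def
  proof (intro exI conjI allI ballI impI)
    show "finite T" using S(1) fin by (simp add: T_def)
    show "T \<subseteq> {w \<in> words. val w = \<one>}" using S(2) sv u X_carrier by (auto simp: T_def)
    show "0 \<le> K * real L + 1" using K by simp
  qed (rule bound; assumption)
qed

section \<open>The Cayley graph as a metric space\<close>

text \<open>Formal inverses count as letters, so this distance is symmetric for every
  \<open>X\<close>; by \<open>graph_dist_eq\<close> it is the graph distance when \<open>X\<close>
  is closed under inverses.\<close>

definition word_dist :: "'a \<Rightarrow> 'a \<Rightarrow> nat" where
  "word_dist u v = (LEAST n. \<exists>w \<in> words. length w = n \<and> u \<otimes> val w = v)"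

lemma word_dist_le: "w \<in> words \<Longrightarrow> word_dist u (u \<otimes> val w) \<le> length w"
  unfolding word_dist_def by (rule Least_le) blast

lemma shortest_word:
  assumes "u \<in> carrier G" "v \<in> carrier G"
  obtains w where "w \<in> words" "length w = word_dist u v" "u \<otimes> val w = v"
proof -
  obtain w where w: "w \<in> words" "val w = inv u \<otimes> v" using word_of[of "inv u \<otimes> v"] assms by auto
  then have "\<exists>w \<in> words. length w = length w \<and> u \<otimes> val w = v" using assms
    by (auto simp: m_assoc[symmetric] intro!: bexI[of _ w])
  then have "\<exists>n. \<exists>w \<in> words. length w = n \<and> u \<otimes> val w = v" by blast
  from LeastI_ex[OF this] show ?thesis using that unfolding word_dist_def by blast
qed

lemma word_dist_step: "u \<in> carrier G \<Longrightarrow> l \<in> (X \<times> UNIV) <+> H \<Longrightarrow> word_dist u (u \<otimes> lval l) \<le> 1"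
  using word_dist_le[of "[l]" u] by (simp add: lval_closed)

lemma word_dist_step_ex:
  assumes "u \<in> carrier G" "v \<in> carrier G" "word_dist u v \<le> 1"
  obtains l where "l \<in> (X \<times> UNIV) <+> H" "u \<otimes> lval l = v"
proof -
  obtain w where w: "w \<in> words" "length w = word_dist u v" "u \<otimes> val w = v"
    by (rule shortest_word[OF assms(1,2)])
  show ?thesis
  proof (cases w)
    case Nil
    \<comment> \<open>A stationary step is realised by the loop edge labelled by the identity of
      \<open>H\<close>.\<close>
    then show ?thesis using that[of "Inr \<one>"] w assms by simp
  next
    case (Cons l w')
    have "length w \<le> 1" using w(2) assms(3) by linarith
    then have "w' = []" using Cons by simp
    then show ?thesis using that[of l] w Cons by (simp add: lval_closed)
  qed
qed

sublocale M: integer_geodesic_space "carrier G" word_dist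
proof unfold_locales
  fix u v w assume u: "u \<in> carrier G"
  show "word_dist u u = 0" using word_dist_le[of "[]" u] u by simp
  assume v: "v \<in> carrier G"
  have "word_dist b a \<le> word_dist a b" if ab: "a \<in> carrier G" "b \<in> carrier G" for a b
  proof -
    obtain w where w: "w \<in> words" "length w = word_dist a b" "a \<otimes> val w = b"
      by (rule shortest_word[OF ab])
    have "b \<otimes> val (winv w) = a" using w ab by (auto simp: m_assoc)
    then show ?thesis using word_dist_le[of "winv w" b] w by simp
  qed
  then show "word_dist u v = word_dist v u" using u v by (simp add: le_antisym)
  obtain p where p: "p \<in> words" "length p = word_dist u v" "u \<otimes> val p = v"
    by (rule shortest_word[OF u v])
  show "\<exists>\<gamma>. \<gamma> 0 = u \<and> \<gamma> (word_dist u v) = v \<and> (\<forall>i \<le> word_dist u v. \<gamma> i \<in> carrier G) \<and>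
      (\<forall>i < word_dist u v. word_dist (\<gamma> i) (\<gamma> (Suc i)) \<le> 1)"
  proof (intro exI[of _ "\<lambda>i. u \<otimes> val (take i p)"] conjI allI impI)
    fix i assume i: "i < word_dist u v"
    have "take (Suc i) p = take i p @ [p ! i]" using i p(2) by (simp add: take_Suc_conv_app_nth)
    moreover have l: "p ! i \<in> (X \<times> UNIV) <+> H" using i p by (auto simp: rel_words_def)
    ultimately show "word_dist (u \<otimes> val (take i p)) (u \<otimes> val (take (Suc i) p)) \<le> 1"
      using word_dist_step[of "u \<otimes> val (take i p)" "p ! i"] words_take_drop[OF p(1), of i] u
      by (simp add: m_assoc lval_closed)
  qed (use p u words_take_drop in auto)
  assume w: "w \<in> carrier G"
  obtain q where q: "q \<in> words" "length q = word_dist v w" "v \<otimes> val q = w"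
    by (rule shortest_word[OF v w])
  have "u \<otimes> val (p @ q) = w" using p q u by (simp add: m_assoc[symmetric])
  then show "word_dist u w \<le> word_dist u v + word_dist v w"
    using word_dist_le[of "p @ q" u] p q by simp
qed

section \<open>Edge paths of the Cayley graph as words\<close>

abbreviation \<Gamma> where "\<Gamma> \<equiv> cayley_graph G X H"

lemma awalk_Nil: "pre_digraph.awalk \<Gamma> u [] v \<longleftrightarrow> u \<in> carrier G \<and> u = v"
  by (simp add: pre_digraph.awalk_def pre_digraph.cas.simps cayley_graph_def)

lemma letter_val_simps [simp]: "letter_val (Inl x) = x" "letter_val (Inr h) = h"
  by (simp_all add: letter_val_def)

lemma letter_val_closed: "l \<in> X <+> H \<Longrightarrow> letter_val l \<in> carrier G"
  using X_carrier by auto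

lemma awalk_Cons:
  "pre_digraph.awalk \<Gamma> u (e # p) v \<longleftrightarrow>
     u \<in> carrier G \<and> fst e = u \<and> snd e \<in> X <+> H \<and>
     pre_digraph.awalk \<Gamma> (u \<otimes> letter_val (snd e)) p v"
  by (cases e) (auto simp: pre_digraph.awalk_def pre_digraph.cas.simps cayley_graph_def
      simp del: letter_val_simps intro: letter_val_closed)

lemma awalk_verts_simps:
  "pre_digraph.awalk_verts \<Gamma> u [] = [u]"
  "pre_digraph.awalk_verts \<Gamma> u (e # p) =
     fst e # pre_digraph.awalk_verts \<Gamma> (fst e \<otimes> letter_val (snd e)) p"
  by (simp_all add: pre_digraph.awalk_verts.simps cayley_graph_def split_beta)

definition to_letter :: "'a + 'a \<Rightarrow> 'a \<times> bool + 'a" where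
  "to_letter = case_sum (\<lambda>x. Inl (x, True)) Inr"

text \<open>A formal inverse becomes the letter of the actual inverse, available when
  \<open>X\<close> is symmetric. Letters keep their side of the disjoint alphabet, on which
  admissibility of a path depends.\<close>

definition of_letter :: "'a \<times> bool + 'a \<Rightarrow> 'a + 'a" where
  "of_letter l = (case l of Inl p \<Rightarrow> Inl (lval l) | Inr h \<Rightarrow> Inr h)"

lemma to_letter: "l \<in> X <+> H \<Longrightarrow> to_letter l \<in> (X \<times> UNIV) <+> H \<and> lval (to_letter l) = letter_val l"
  by (cases l) (auto simp: to_letter_def)

lemma of_letter:
  assumes "inv_closed G X" "l \<in> (X \<times> UNIV) <+> H"
  shows "of_letter l \<in> X <+> H \<and> letter_val (of_letter l) = lval l"
proof (cases l)
  case (Inl p)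
  then have "lval l \<in> X" using assms by (cases p) (simp add: inv_closed_def)
  then show ?thesis using Inl by (simp add: of_letter_def InlI)
next
  case (Inr h)
  then show ?thesis using assms(2) by (simp add: of_letter_def InrI)
qed

definition path_word :: "('a \<times> ('a + 'a)) list \<Rightarrow> 'a rel_word" where
  "path_word p = map (to_letter \<circ> snd) p"

lemma length_path_word [simp]: "length (path_word p) = length p"
  by (simp add: path_word_def)

lemma path_word:
  "pre_digraph.awalk \<Gamma> u p v \<Longrightarrow> u \<in> carrier G \<and> path_word p \<in> words \<and> u \<otimes> val (path_word p) = v"
proof (induction p arbitrary: u)
  case (Cons e p)
  then have "u \<in> carrier G" "snd e \<in> X <+> H" "pre_digraph.awalk \<Gamma> (u \<otimes> letter_val (snd e)) p v"
    by (auto simp: awalk_Cons)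
  then have p: "path_word p \<in> words" "u \<otimes> letter_val (snd e) \<otimes> val (path_word p) = v"
    and e: "to_letter (snd e) \<in> (X \<times> UNIV) <+> H" "lval (to_letter (snd e)) = letter_val (snd e)"
    and u: "u \<in> carrier G" "letter_val (snd e) \<in> carrier G"
    using Cons.IH[of "u \<otimes> letter_val (snd e)"] to_letter[of "snd e"] letter_val_closed[of "snd e"]
    by simp_all
  have "path_word (e # p) = to_letter (snd e) # path_word p" by (simp add: path_word_def)
  then show ?case using p(1) p(2)[symmetric] e u by (simp only: words_simps val_simps) (simp add: m_assoc)
qed (auto simp: awalk_Nil path_word_def)

primrec word_path :: "'a \<Rightarrow> 'a rel_word \<Rightarrow> ('a \<times> ('a + 'a)) list" where
  "word_path u [] = []"
| "word_path u (l # w) = (u, of_letter l) # word_path (u \<otimes> lval l) w"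

lemma length_word_path [simp]: "length (word_path u w) = length w"
  by (induction w arbitrary: u) simp_all

lemma word_path:
  assumes "inv_closed G X"
  shows "u \<in> carrier G \<Longrightarrow> w \<in> words \<Longrightarrow> pre_digraph.awalk \<Gamma> u (word_path u w) (u \<otimes> val w)"
proof (induction w arbitrary: u)
  case (Cons l w)
  have l: "l \<in> (X \<times> UNIV) <+> H" "lval l \<in> carrier G" "w \<in> words"
    using Cons.prems lval_closed by simp_all
  have "u \<otimes> lval l \<otimes> val w = u \<otimes> (lval l \<otimes> val w)" using l Cons.prems(1) by (simp add: m_assoc)
  then show ?case
    using Cons.IH[of "u \<otimes> lval l"] Cons.prems(1) l of_letter[OF assms l(1)] by (simp add: awalk_Cons)
qed (simp add: awalk_Nil)

lemma graph_dist_eq: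
  assumes "inv_closed G X" "u \<in> carrier G" "v \<in> carrier G"
  shows "graph_dist \<Gamma> u v = enat (word_dist u v)"
proof (rule antisym)
  obtain w where w: "w \<in> words" "length w = word_dist u v" "u \<otimes> val w = v"
    by (rule shortest_word[OF assms(2,3)])
  show "graph_dist \<Gamma> u v \<le> enat (word_dist u v)"
    unfolding graph_dist_def
    using word_path[OF assms(1,2) w(1)] w by (intro INF_lower2[of "word_path u w"]) auto
  show "enat (word_dist u v) \<le> graph_dist \<Gamma> u v"
    unfolding graph_dist_def
  proof (rule INF_greatest)
    fix p assume "p \<in> {p. pre_digraph.awalk \<Gamma> u p v}"
    then show "enat (word_dist u v) \<le> enat (length p)"
      using path_word[of u p v] word_dist_le[of "path_word p" u] by auto
  qed
qed

lemma awalk_path: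
  "pre_digraph.awalk \<Gamma> u p v \<Longrightarrow>
     \<exists>\<gamma>. \<gamma> 0 = u \<and> \<gamma> (length p) = v \<and> (\<forall>i \<le> length p. \<gamma> i \<in> carrier G) \<and>
       (\<forall>i < length p. word_dist (\<gamma> i) (\<gamma> (Suc i)) \<le> 1) \<and>
       set (pre_digraph.awalk_verts \<Gamma> u p) = \<gamma> ` {..length p}"
proof (induction p arbitrary: u)
  case Nil
  then show ?case by (auto simp: awalk_Nil awalk_verts_simps)
next
  case (Cons e p)
  define u' where "u' = u \<otimes> letter_val (snd e)"
  have u: "u \<in> carrier G" "snd e \<in> X <+> H" "fst e = u" "pre_digraph.awalk \<Gamma> u' p v"
    using Cons.prems by (auto simp: awalk_Cons u'_def)
  obtain \<gamma> where g: "\<gamma> 0 = u'" "\<gamma> (length p) = v" "\<forall>i \<le> length p. \<gamma> i \<in> carrier G"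
       "\<forall>i < length p. word_dist (\<gamma> i) (\<gamma> (Suc i)) \<le> 1"
       "set (pre_digraph.awalk_verts \<Gamma> u' p) = \<gamma> ` {..length p}"
    using Cons.IH[OF u(4)] by auto
  have "word_dist u u' \<le> 1"
    using word_dist_step[OF u(1), of "to_letter (snd e)"] to_letter[OF u(2)] by (simp add: u'_def)
  show ?case
  proof (intro exI[of _ "case_nat u \<gamma>"] conjI allI impI)
    show "case_nat u \<gamma> i \<in> carrier G" if "i \<le> length (e # p)" for i
      using that u(1) g(3) by (cases i) simp_all
    show "word_dist (case_nat u \<gamma> i) (case_nat u \<gamma> (Suc i)) \<le> 1" if "i < length (e # p)" for i
      using that \<open>word_dist u u' \<le> 1\<close> g(1,4) by (cases i) simp_all
    show "set (pre_digraph.awalk_verts \<Gamma> u (e # p)) = case_nat u \<gamma> ` {..length (e # p)}"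
      unfolding length_Cons atMost_Suc_eq_insert_0 image_insert image_image
      using u(3) g(5) by (simp add: awalk_verts_simps u'_def)
  qed (use g(2) in simp_all)
qed

lemma path_awalk:
  assumes X: "inv_closed G X"
  shows "(\<forall>i \<le> n. \<gamma> i \<in> carrier G) \<Longrightarrow> (\<forall>i < n. word_dist (\<gamma> i) (\<gamma> (Suc i)) \<le> 1) \<Longrightarrow>
    \<exists>p. pre_digraph.awalk \<Gamma> (\<gamma> 0) p (\<gamma> n) \<and> length p = n \<and>
      set (pre_digraph.awalk_verts \<Gamma> (\<gamma> 0) p) = \<gamma> ` {..n}"
proof (induction n arbitrary: \<gamma>)
  case 0
  then show ?case by (auto simp: awalk_Nil awalk_verts_simps intro!: exI[of _ "[]"])
next
  case (Suc n)
  obtain p where p: "pre_digraph.awalk \<Gamma> (\<gamma> (Suc 0)) p (\<gamma> (Suc n))" "length p = n"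
      "set (pre_digraph.awalk_verts \<Gamma> (\<gamma> (Suc 0)) p) = (\<lambda>i. \<gamma> (Suc i)) ` {..n}"
    using Suc.IH[of "\<lambda>i. \<gamma> (Suc i)"] Suc.prems by auto
  obtain l where l: "l \<in> (X \<times> UNIV) <+> H" "\<gamma> 0 \<otimes> lval l = \<gamma> (Suc 0)"
    using word_dist_step_ex[of "\<gamma> 0" "\<gamma> (Suc 0)"] Suc.prems by auto
  show ?case
    unfolding atMost_Suc_eq_insert_0 image_insert image_image
    using p l of_letter[OF X l(1)] Suc.prems
    by (intro exI[of _ "(\<gamma> 0, of_letter l) # p"]) (simp add: awalk_Cons awalk_verts_simps)
qed

lemma geodesic_geod:
  assumes X: "inv_closed G X" and p: "geodesic \<Gamma> u p v"
  obtains \<gamma> where "M.geod \<gamma> (length p)" "\<gamma> 0 = u" "\<gamma> (length p) = v"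
    "set (pre_digraph.awalk_verts \<Gamma> u p) = \<gamma> ` {..length p}"
proof -
  have w: "pre_digraph.awalk \<Gamma> u p v" "enat (length p) = graph_dist \<Gamma> u v"
    using p by (auto simp: geodesic_def)
  have uv: "u \<in> carrier G" "v \<in> carrier G" using path_word[OF w(1)] by auto
  have "length p = word_dist u v" using w(2) graph_dist_eq[OF X uv] by simp
  moreover obtain \<gamma> where g: "\<gamma> 0 = u" "\<gamma> (length p) = v" "\<forall>i \<le> length p. \<gamma> i \<in> carrier G"
      "\<forall>i < length p. word_dist (\<gamma> i) (\<gamma> (Suc i)) \<le> 1"
      "set (pre_digraph.awalk_verts \<Gamma> u p) = \<gamma> ` {..length p}"
    using awalk_path[OF w(1)] by blast
  ultimately have "M.geod \<gamma> (length p)" by (intro M.geodI) simp_all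
  then show ?thesis using g by (intro that[of \<gamma>])
qed

lemma geod_geodesic:
  assumes X: "inv_closed G X" and g: "M.geod \<gamma> n"
  obtains p where "geodesic \<Gamma> (\<gamma> 0) p (\<gamma> n)" "length p = n"
    "set (pre_digraph.awalk_verts \<Gamma> (\<gamma> 0) p) = \<gamma> ` {..n}"
proof -
  obtain p where p: "pre_digraph.awalk \<Gamma> (\<gamma> 0) p (\<gamma> n)" "length p = n"
      "set (pre_digraph.awalk_verts \<Gamma> (\<gamma> 0) p) = \<gamma> ` {..n}"
    using path_awalk[OF X, of n \<gamma>] M.geod_in[OF g] M.geod_dist[OF g] by auto
  moreover have "geodesic \<Gamma> (\<gamma> 0) p (\<gamma> n)"
    using p(1,2) graph_dist_eq[OF X M.geod_in[OF g] M.geod_in[OF g]] M.geod_dist[OF g, of 0 n]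
    by (simp add: geodesic_def)
  ultimately show ?thesis using that by blast
qed

lemma hyperbolic_graph_iff:
  assumes X: "inv_closed G X"
  shows "hyperbolic_graph \<Gamma> \<longleftrightarrow> (\<exists>\<delta>. \<forall>N. M.slim \<delta> N)"
proof
  assume "hyperbolic_graph \<Gamma>"
  then obtain \<delta> where \<delta>: "\<forall>x y z p q r. geodesic \<Gamma> x p y \<and> geodesic \<Gamma> y q z \<and> geodesic \<Gamma> z r x \<longrightarrow>
      (\<forall>a \<in> set (pre_digraph.awalk_verts \<Gamma> x p).
      \<exists>b \<in> set (pre_digraph.awalk_verts \<Gamma> y q) \<union> set (pre_digraph.awalk_verts \<Gamma> z r).
        graph_dist \<Gamma> a b \<le> enat \<delta>)"
    unfolding hyperbolic_graph_def by (rule exE)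
  have "M.slim \<delta> N" for N
    unfolding M.slim_def
  proof (intro allI impI)
    fix \<alpha> \<beta> \<gamma> l m n i
    assume t: "M.geod \<alpha> l" "M.geod \<beta> m" "M.geod \<gamma> n" "\<alpha> l = \<beta> 0" "\<beta> m = \<gamma> 0" "\<gamma> n = \<alpha> 0" and i: "i \<le> l"
    obtain p where p: "geodesic \<Gamma> (\<alpha> 0) p (\<alpha> l)" "set (pre_digraph.awalk_verts \<Gamma> (\<alpha> 0) p) = \<alpha> ` {..l}"
      by (rule geod_geodesic[OF X t(1)])
    obtain q where q: "geodesic \<Gamma> (\<beta> 0) q (\<beta> m)" "set (pre_digraph.awalk_verts \<Gamma> (\<beta> 0) q) = \<beta> ` {..m}"
      by (rule geod_geodesic[OF X t(2)])
    obtain r where r: "geodesic \<Gamma> (\<gamma> 0) r (\<gamma> n)" "set (pre_digraph.awalk_verts \<Gamma> (\<gamma> 0) r) = \<gamma> ` {..n}"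
      by (rule geod_geodesic[OF X t(3)])
    have "geodesic \<Gamma> (\<alpha> 0) p (\<beta> 0) \<and> geodesic \<Gamma> (\<beta> 0) q (\<gamma> 0) \<and> geodesic \<Gamma> (\<gamma> 0) r (\<alpha> 0)"
      "\<alpha> i \<in> set (pre_digraph.awalk_verts \<Gamma> (\<alpha> 0) p)"
      using p q r t i by simp_all
    from \<delta>[rule_format, OF this]
    obtain b where b: "b \<in> \<beta> ` {..m} \<union> \<gamma> ` {..n}" "graph_dist \<Gamma> (\<alpha> i) b \<le> enat \<delta>"
      unfolding q(2) r(2) by (rule bexE)
    have "b \<in> carrier G" using b(1) M.geod_in[OF t(2)] M.geod_in[OF t(3)] by auto
    then show "\<exists>b \<in> \<beta> ` {..m} \<union> \<gamma> ` {..n}. word_dist (\<alpha> i) b \<le> \<delta>"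
      using b graph_dist_eq[OF X M.geod_in[OF t(1) i]] by auto
  qed
  then show "\<exists>\<delta>. \<forall>N. M.slim \<delta> N" by blast
next
  assume "\<exists>\<delta>. \<forall>N. M.slim \<delta> N"
  then obtain \<delta> where \<delta>: "\<And>N. M.slim \<delta> N" by blast
  show "hyperbolic_graph \<Gamma>"
    unfolding hyperbolic_graph_def
  proof (intro exI[of _ \<delta>] allI impI ballI)
    fix x y z p q r a
    assume t: "geodesic \<Gamma> x p y \<and> geodesic \<Gamma> y q z \<and> geodesic \<Gamma> z r x"
      and a: "a \<in> set (pre_digraph.awalk_verts \<Gamma> x p)"
    obtain \<alpha> where p: "M.geod \<alpha> (length p)" "\<alpha> 0 = x" "\<alpha> (length p) = y"
        "set (pre_digraph.awalk_verts \<Gamma> x p) = \<alpha> ` {..length p}"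
      by (rule geodesic_geod[OF X t[THEN conjunct1]])
    obtain \<beta> where q: "M.geod \<beta> (length q)" "\<beta> 0 = y" "\<beta> (length q) = z"
        "set (pre_digraph.awalk_verts \<Gamma> y q) = \<beta> ` {..length q}"
      by (rule geodesic_geod[OF X t[THEN conjunct2, THEN conjunct1]])
    obtain \<gamma> where r: "M.geod \<gamma> (length r)" "\<gamma> 0 = z" "\<gamma> (length r) = x"
        "set (pre_digraph.awalk_verts \<Gamma> z r) = \<gamma> ` {..length r}"
      by (rule geodesic_geod[OF X t[THEN conjunct2, THEN conjunct2]])
    obtain i where i: "i \<le> length p" "a = \<alpha> i" using a p(4) by auto
    obtain b where b: "b \<in> \<beta> ` {..length q} \<union> \<gamma> ` {..length r}" "word_dist (\<alpha> i) b \<le> \<delta>"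
      by (rule M.slimD[OF \<delta> p(1) q(1) r(1) _ _ _ order.refl i(1)]) (use p q r in auto)
    have "b \<in> carrier G" using b(1) M.geod_in[OF q(1)] M.geod_in[OF r(1)] by auto
    then show "\<exists>b \<in> set (pre_digraph.awalk_verts \<Gamma> y q) \<union> set (pre_digraph.awalk_verts \<Gamma> z r).
        graph_dist \<Gamma> a b \<le> enat \<delta>"
      using b(2) i(2) graph_dist_eq[OF X M.geod_in[OF p(1) i(1)]]
      unfolding q(4) r(4) by (intro bexI[OF _ b(1)]) simp
  qed
qed

section \<open>From isoperimetry to hyperbolic embedding\<close>

definition coset_rep :: "'a \<Rightarrow> 'a" where
  "coset_rep g = (SOME r. r \<in> g <# H)"

lemma coset_rep:
  assumes "g \<in> carrier G"
  shows "\<exists>h \<in> H. coset_rep g = g \<otimes> h"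
proof -
  have "g \<in> g <# H" using assms H.one_closed by (force simp: l_coset_def)
  then have "coset_rep g \<in> g <# H" unfolding coset_rep_def by (rule someI)
  then show ?thesis by (auto simp: l_coset_def)
qed

lemma coset_rep_mult:
  assumes "g \<in> carrier G" "h \<in> H"
  shows "coset_rep (g \<otimes> h) = coset_rep g"
proof -
  have "g \<otimes> h \<in> g <# H" using assms by (auto simp: l_coset_def)
  then have "g <# H = (g \<otimes> h) <# H" using assms l_repr_independence H.subgroup_axioms by blast
  then show ?thesis by (simp add: coset_rep_def)
qed

text \<open>A discretisation of the form \<open>\<psi> d\<phi>\<close>; freezing \<open>\<psi>\<close> on every coset of \<open>H\<close> makes it exact there.\<close>

definition coset_form :: "('a \<Rightarrow> real) \<Rightarrow> ('a \<Rightarrow> real) \<Rightarrow> 'a \<Rightarrow> 'a \<times> bool + 'a \<Rightarrow> real" where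
  "coset_form \<psi> \<phi> g l = (case l of
      Inl p \<Rightarrow> (if snd p then \<psi> g else \<psi> (g \<otimes> inv (fst p))) * (\<phi> (g \<otimes> lval l) - \<phi> g)
    | Inr h \<Rightarrow> \<psi> (coset_rep g) * (\<phi> (g \<otimes> h) - \<phi> g))"

text \<open>On an edge labelled in \<open>X\<close> the weight is taken at the tail of its positive
  orientation, so opposite edges have opposite values. On a coset of \<open>H\<close> the weight is
  constant, so the form is there the differential of a multiple of \<phi>.\<close>

lemma cochain_coset_form: "cochain (coset_form \<psi> \<phi>)"
  unfolding cochain_def
proof (intro conjI ballI allI)
  fix g x b assume "g \<in> carrier G" "x \<in> X"
  then show "coset_form \<psi> \<phi> g (Inl (x, b)) + coset_form \<psi> \<phi> (g \<otimes> lval (Inl (x, b))) (Inl (x, \<not> b)) = 0"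
    using X_carrier by (cases b) (auto simp: coset_form_def m_assoc subset_iff algebra_simps)
next
  fix g h h' assume "g \<in> carrier G" "h \<in> H" "h' \<in> H"
  then show "coset_form \<psi> \<phi> g (Inr h) + coset_form \<psi> \<phi> (g \<otimes> h) (Inr h') = coset_form \<psi> \<phi> g (Inr (h \<otimes> h'))"
    by (simp add: coset_form_def coset_rep_mult m_assoc algebra_simps)
qed

lemma lip1_bound: "M.lip1 \<phi> \<Longrightarrow> u \<in> carrier G \<Longrightarrow> v \<in> carrier G \<Longrightarrow> \<bar>\<phi> u - \<phi> v\<bar> \<le> real (word_dist u v)"
  by (simp add: M.lip1_def)

lemma lip1_step:
  assumes "M.lip1 \<phi>" "g \<in> carrier G" "l \<in> (X \<times> UNIV) <+> H"
  shows "\<bar>\<phi> (g \<otimes> lval l) - \<phi> g\<bar> \<le> 1"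
proof -
  have "word_dist g (g \<otimes> lval l) \<le> 1" using word_dist_step assms by blast
  then show ?thesis
    using lip1_bound[OF assms(1), of g "g \<otimes> lval l"] assms(2) lval_closed[OF assms(3)] by simp
qed

text \<open>Every vertex at which \<psi> may be evaluated is within distance one of
  \<open>g\<close>; for the coset representative this holds because a single \<open>H\<close>-edge
  joins any two points of a coset.\<close>

lemma coset_form_step:
  assumes "M.lip1 \<psi>" "g \<in> carrier G" "l \<in> (X \<times> UNIV) <+> H"
  obtains c where "coset_form \<psi> \<phi> g l = c * (\<phi> (g \<otimes> lval l) - \<phi> g)" "\<bar>c - \<psi> g\<bar> \<le> 1"
proof (cases l)
  case (Inl p)
  then obtain x b where l: "l = Inl (x, b)" "x \<in> X" using assms(3) by (cases p) auto
  show ?thesis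
  proof (cases b)
    case True
    then show ?thesis using that[of "\<psi> g"] l by (simp add: coset_form_def)
  next
    case False
    then show ?thesis
      using that[of "\<psi> (g \<otimes> inv x)"] l lip1_step[OF assms(1,2), of "Inl (x, False)"]
      by (simp add: coset_form_def)
  qed
next
  case (Inr h)
  obtain k where k: "k \<in> H" "coset_rep g = g \<otimes> k" using coset_rep assms(2) by blast
  show ?thesis
    using that[of "\<psi> (coset_rep g)"] Inr k lip1_step[OF assms(1,2), of "Inr k"]
    by (simp add: coset_form_def)
qed

text \<open>Replacing all weights by the constant \<open>\<psi> g0\<close> makes the form exact, so
  on a loop nothing remains but the error. That is at most \<open>Suc n\<close> per step as long as
  the path stays within \<open>n\<close> of \<open>g0\<close>, however large \<psi> is.\<close>

lemma coset_form_loop: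
  assumes \<psi>: "M.lip1 \<psi>" and \<phi>: "M.lip1 \<phi>" and g0: "g0 \<in> carrier G"
  shows "w \<in> words \<Longrightarrow> g \<in> carrier G \<Longrightarrow> word_dist g0 g + length w \<le> n \<Longrightarrow>
    \<bar>word_int (coset_form \<psi> \<phi>) g w - \<psi> g0 * (\<phi> (g \<otimes> val w) - \<phi> g)\<bar> \<le> real (Suc n) * real (length w)"
proof (induction w arbitrary: g)
  case (Cons l w)
  have l: "l \<in> (X \<times> UNIV) <+> H" "lval l \<in> carrier G" "w \<in> words"
    using Cons.prems lval_closed by simp_all
  define g' where "g' = g \<otimes> lval l"
  have g': "g' \<in> carrier G" using l Cons.prems(2) by (simp add: g'_def)
  have "word_dist g g' \<le> 1" using word_dist_step Cons.prems(2) l by (simp add: g'_def)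
  then have "word_dist g0 g' + length w \<le> n"
    using M.dist_triangle[OF g0 Cons.prems(2) g'] Cons.prems(3) by simp
  then have IH: "\<bar>word_int (coset_form \<psi> \<phi>) g' w - \<psi> g0 * (\<phi> (g' \<otimes> val w) - \<phi> g')\<bar> \<le>
      real (Suc n) * real (length w)"
    using Cons.IH g' l by simp
  obtain c where c: "coset_form \<psi> \<phi> g l = c * (\<phi> g' - \<phi> g)" "\<bar>c - \<psi> g\<bar> \<le> 1"
    unfolding g'_def by (rule coset_form_step[OF \<psi> Cons.prems(2) l(1)])
  have "\<bar>\<psi> g0 - \<psi> g\<bar> \<le> real n" using lip1_bound[OF \<psi> g0 Cons.prems(2)] Cons.prems(3) by simp
  then have "\<bar>c - \<psi> g0\<bar> \<le> real (Suc n)" using c(2) by simp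
  moreover have "\<bar>\<phi> g' - \<phi> g\<bar> \<le> 1" unfolding g'_def using lip1_step[OF \<phi> Cons.prems(2) l(1)] .
  ultimately have "\<bar>c - \<psi> g0\<bar> * \<bar>\<phi> g' - \<phi> g\<bar> \<le> real (Suc n) * 1" by (intro mult_mono) auto
  then have step: "\<bar>c * (\<phi> g' - \<phi> g) - \<psi> g0 * (\<phi> g' - \<phi> g)\<bar> \<le> real (Suc n)"
    by (simp add: abs_mult[symmetric] left_diff_distrib)
  have "g \<otimes> val (l # w) = g' \<otimes> val w" using l Cons.prems(2) by (simp add: g'_def m_assoc)
  moreover have "word_int (coset_form \<psi> \<phi>) g (l # w) = c * (\<phi> g' - \<phi> g) + word_int (coset_form \<psi> \<phi>) g' w"
    by (simp add: c(1) g'_def)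
  ultimately have "word_int (coset_form \<psi> \<phi>) g (l # w) - \<psi> g0 * (\<phi> (g \<otimes> val (l # w)) - \<phi> g) =
      (c * (\<phi> g' - \<phi> g) - \<psi> g0 * (\<phi> g' - \<phi> g)) +
      (word_int (coset_form \<psi> \<phi>) g' w - \<psi> g0 * (\<phi> (g' \<otimes> val w) - \<phi> g'))"
    by (simp add: right_diff_distrib)
  moreover have "real (Suc n) * real (length (l # w)) = real (Suc n) + real (Suc n) * real (length w)"
    by (simp add: algebra_simps)
  ultimately show ?case using IH step by (simp only: order_trans[OF abs_triangle_ineq] add_mono)
qed simp

text \<open>The weight of an edge differs from \<psi> at its tail by at most one and \<phi> changes
  by at most one, so passing from \<psi> d\<phi> to the coset form costs at most one per
  step.\<close>

lemma coset_form_path: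
  assumes \<psi>: "M.lip1 \<psi>" and \<phi>: "M.lip1 \<phi>"
  shows "u \<in> carrier G \<Longrightarrow> M.edge_path u p \<Longrightarrow>
    \<exists>w \<in> words. length w = length p \<and> u \<otimes> val w = last (u # p) \<and>
      \<bar>word_int (coset_form \<psi> \<phi>) u w - M.line_int \<psi> \<phi> u p\<bar> \<le> real (length p)"
proof (induction p arbitrary: u)
  case Nil
  then show ?case by (auto intro!: bexI[of _ "[]"])
next
  case (Cons v p)
  have v: "v \<in> carrier G" "word_dist u v \<le> 1" "M.edge_path v p" using Cons.prems(2) by auto
  obtain w where w: "w \<in> words" "length w = length p" "v \<otimes> val w = last (v # p)"
      "\<bar>word_int (coset_form \<psi> \<phi>) v w - M.line_int \<psi> \<phi> v p\<bar> \<le> real (length p)"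
    using Cons.IH[OF v(1,3)] by blast
  obtain l where l: "l \<in> (X \<times> UNIV) <+> H" "u \<otimes> lval l = v"
    by (rule word_dist_step_ex[OF Cons.prems(1) v(1,2)])
  obtain c where c: "coset_form \<psi> \<phi> u l = c * (\<phi> v - \<phi> u)" "\<bar>c - \<psi> u\<bar> \<le> 1"
    using coset_form_step[OF \<psi> Cons.prems(1) l(1)] unfolding l(2) by blast
  have "\<bar>c - \<psi> u\<bar> * \<bar>\<phi> v - \<phi> u\<bar> \<le> 1 * 1"
    using c(2) lip1_step[OF \<phi> Cons.prems(1) l(1)] l(2) by (intro mult_mono) auto
  then have "\<bar>c * (\<phi> v - \<phi> u) - \<psi> u * (\<phi> v - \<phi> u)\<bar> \<le> 1"
    by (simp add: abs_mult[symmetric] left_diff_distrib)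
  moreover have "u \<otimes> val (l # w) = v \<otimes> val w"
    using l w(1) Cons.prems(1) lval_closed[OF l(1)] by (simp add: m_assoc[symmetric])
  ultimately show ?case using w l c by (intro bexI[of _ "l # w"]) auto
qed

theorem hyperbolic_if_dual_linear_isoperimetric:
  assumes "dual_linear_isoperimetric" "inv_closed G X"
  shows "hyperbolic_graph \<Gamma>"
proof -
  obtain S K where S: "finite S" "S \<subseteq> {w \<in> words. val w = \<one>}" and K: "0 \<le> K"
    and dual: "\<And>f B g w. cochain f \<Longrightarrow> 0 \<le> B \<Longrightarrow> (\<forall>g \<in> carrier G. \<forall>s \<in> S. \<bar>word_int f g s\<bar> \<le> B) \<Longrightarrow>
      g \<in> carrier G \<Longrightarrow> w \<in> words \<Longrightarrow> val w = \<one> \<Longrightarrow> \<bar>word_int f g w\<bar> \<le> K * B * real (length w)"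
    by (rule dual_linear_isoperimetricE[OF assms(1)]) (rule that; assumption)
  define n where "n = (\<Sum>s\<in>S. length s)"
  have n: "length s \<le> n" if "s \<in> S" for s using that S(1) by (auto simp: n_def intro: member_le_sum)
  \<comment> \<open>\<open>coset_form_loop\<close>, based at the start of a test loop of length at
    most \<open>n\<close>, bounds the integral over it by \<open>B\<close>. The summand 1 in
    \<open>K'\<close> pays for \<open>coset_form_path\<close>.\<close>
  define B where "B = real (Suc n) * real n"
  define K' where "K' = K * B + 1"
  have K': "0 \<le> K'" using K by (simp add: K'_def B_def)
  have stokes: "M.line_int \<psi> \<phi> u p \<le> K' * real (length p)"
    if lip: "M.lip1 \<psi>" "M.lip1 \<phi>" and u: "u \<in> carrier G" "M.edge_path u p" "last (u # p) = u" for \<psi> \<phi> u p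
  proof -
    have bound: "\<bar>word_int (coset_form \<psi> \<phi>) g s\<bar> \<le> B" if "g \<in> carrier G" "s \<in> S" for g s
    proof -
      have "s \<in> words" "val s = \<one>" using that(2) S(2) by auto
      then have "\<bar>word_int (coset_form \<psi> \<phi>) g s\<bar> \<le> real (Suc n) * real (length s)"
        using coset_form_loop[OF lip that(1), of s g n] that n[OF that(2)] M.dist_self[OF that(1)] by simp
      also have "\<dots> \<le> B" unfolding B_def using n[OF that(2)] by (intro mult_left_mono) auto
      finally show ?thesis .
    qed
    obtain w where w: "w \<in> words" "length w = length p" "u \<otimes> val w = last (u # p)"
        "\<bar>word_int (coset_form \<psi> \<phi>) u w - M.line_int \<psi> \<phi> u p\<bar> \<le> real (length p)"
      using coset_form_path[OF lip u(1,2)] by blast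
    have "val w = \<one>" using w(1,3) u by simp
    then have "\<bar>word_int (coset_form \<psi> \<phi>) u w\<bar> \<le> K * B * real (length w)"
      by (intro dual[OF cochain_coset_form]) (use bound u(1) w(1) in \<open>auto simp: B_def\<close>)
    then show ?thesis using w(2,4) unfolding K'_def by (simp add: algebra_simps)
  qed
  have "M.slim (nat \<lceil>72 * K'\<rceil>) N" for N
    by (rule M.slim_if_stokes[OF stokes K'])
  then show ?thesis using hyperbolic_graph_iff[OF assms(2)] by blast
qed

section \<open>Truncated word length with respect to a set\<close>

primrec word_ball :: "'a \<Rightarrow> 'a set \<Rightarrow> nat \<Rightarrow> 'a set" where
  "word_ball g A 0 = {g}"
| "word_ball g A (Suc k) = word_ball g A k \<union> (\<lambda>(v, a). v \<otimes> a) ` (word_ball g A k \<times> A)"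

lemma finite_word_ball: "finite A \<Longrightarrow> finite (word_ball g A k)"
  by (induction k) auto

lemma word_ball_mono: "k \<le> n \<Longrightarrow> word_ball g A k \<subseteq> word_ball g A n"
  by (induction n) (auto simp: le_Suc_eq)

text \<open>This is min(\<open>T\<close>, distance from \<open>g\<close> to \<open>v\<close> in the
  word metric of \<open>A\<close>), obtained by counting the balls that miss \<open>v\<close>. The
  truncation keeps it finite where \<open>v\<close> cannot be reached from \<open>g\<close> by
  letters of \<open>A\<close>.\<close>

definition ball_height :: "'a \<Rightarrow> 'a set \<Rightarrow> nat \<Rightarrow> 'a \<Rightarrow> nat" where
  "ball_height g A T v = card {k. k < T \<and> v \<notin> word_ball g A k}"

lemma ball_height_mult:
  assumes "a \<in> A"
  shows "ball_height g A T (v \<otimes> a) \<le> Suc (ball_height g A T v)"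
proof -
  \<comment> \<open>If \<open>v \<otimes> a\<close> misses the ball of radius \<open>k + 1\<close>,
    then \<open>v\<close> misses the ball of radius \<open>k\<close>.\<close>
  have "{k. k < T \<and> v \<otimes> a \<notin> word_ball g A k} \<subseteq> insert 0 (Suc ` {k. k < T \<and> v \<notin> word_ball g A k})"
  proof
    fix k assume k: "k \<in> {k. k < T \<and> v \<otimes> a \<notin> word_ball g A k}"
    then show "k \<in> insert 0 (Suc ` {k. k < T \<and> v \<notin> word_ball g A k})"
      using assms by (cases k) force+
  qed
  then have "ball_height g A T (v \<otimes> a) \<le> card (insert 0 (Suc ` {k. k < T \<and> v \<notin> word_ball g A k}))"
    unfolding ball_height_def by (intro card_mono) auto
  also have "\<dots> \<le> Suc (card (Suc ` {k. k < T \<and> v \<notin> word_ball g A k}))"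
    by (rule card_insert_le_m1) auto
  also have "\<dots> = Suc (ball_height g A T v)"
    by (simp add: ball_height_def card_image)
  finally show ?thesis .
qed

lemma ball_height_self: "ball_height g A T g = 0"
proof -
  have "g \<in> word_ball g A k" for k using word_ball_mono[of 0 k g A] by auto
  then show ?thesis by (simp add: ball_height_def)
qed

lemma ball_height_outside:
  assumes "v \<notin> word_ball g A T"
  shows "ball_height g A T v = T"
proof -
  have "{k. k < T \<and> v \<notin> word_ball g A k} = {..<T}"
    using assms word_ball_mono[of _ T g A] less_imp_le by blast
  then show ?thesis by (simp add: ball_height_def)
qed

text \<open>Closing up an admissible path by an edge of the complete graph on \<open>H\<close> gives a loop
  on which the differential of a function on \<open>H\<close> only sees the closing edge.\<close>

theorem finite_rel_dist_balls_if_dual_linear_isoperimetric: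
  assumes "dual_linear_isoperimetric" and h0: "h0 \<in> H"
  shows "finite {h \<in> H. rel_dist G X H h0 h \<le> enat n}"
proof -
  obtain S K where S: "finite S" "S \<subseteq> {w \<in> words. val w = \<one>}" and K: "0 \<le> K"
    and dual: "\<And>f B g w. cochain f \<Longrightarrow> 0 \<le> B \<Longrightarrow> (\<forall>g \<in> carrier G. \<forall>s \<in> S. \<bar>word_int f g s\<bar> \<le> B) \<Longrightarrow>
      g \<in> carrier G \<Longrightarrow> w \<in> words \<Longrightarrow> val w = \<one> \<Longrightarrow> \<bar>word_int f g w\<bar> \<le> K * B * real (length w)"
    by (rule dual_linear_isoperimetricE[OF assms(1)]) (rule that; assumption)
  \<comment> \<open>Only these finitely many elements of \<open>H\<close> label edges of the test
    loops. A function on \<open>H\<close> that changes by at most one under them therefore has a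
    differential bounded on the test loops.\<close>
  define \<Omega> where "\<Omega> = {h. \<exists>s \<in> S. Inr h \<in> set s}"
  define A where "A = \<Omega> \<union> m_inv G ` \<Omega>"
  define B where "B = real (\<Sum>s\<in>S. length s)"
  \<comment> \<open>Beyond the bound on integrals over loops of length at most \<open>n + 1\<close>,
    that is, an admissible path of length at most \<open>n\<close> and the closing edge.\<close>
  define T where "T = Suc (nat \<lceil>K * B * real (Suc n)\<rceil>)"
  define q where "q = (\<lambda>v. real (ball_height h0 A T v))"
  \<comment> \<open>The differential of \<open>q\<close> on the coset \<open>H\<close>, and zero on
    the other cosets and on all edges labelled in \<open>X\<close>. It is supported on exactly the
    edges that admissible paths avoid, while the single closing edge can carry an integral of
    absolute value \<open>T\<close>.\<close>
  define f where "f = (\<lambda>g (l :: 'a \<times> bool + 'a). case l of Inl p \<Rightarrow> 0 | Inr h \<Rightarrow> if g \<in> H then q (g \<otimes> h) - q g else 0)"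
  have "\<Omega> = (\<Union>s \<in> S. projr ` (set s \<inter> range Inr))" by (force simp: \<Omega>_def)
  then have finA: "finite A" using S(1) by (simp add: A_def)
  have \<Omega>H: "\<Omega> \<subseteq> H" using S(2) by (force simp: \<Omega>_def rel_words_def)
  have multH: "g \<otimes> h \<in> H \<longleftrightarrow> g \<in> H" if "g \<in> carrier G" "h \<in> H" for g h
  proof
    assume "g \<otimes> h \<in> H"
    then have "g \<otimes> h \<otimes> inv h \<in> H" using that by blast
    then show "g \<in> H" using that by (simp add: m_assoc)
  qed (use that in auto)
  have f: "cochain f"
    unfolding cochain_def using multH by (auto simp: f_def m_assoc)
  have f_le: "\<bar>f g (Inr h)\<bar> \<le> 1" if "g \<in> carrier G" "h \<in> \<Omega>" for g h
  proof -
    have h: "h \<in> carrier G" "h \<in> A" "inv h \<in> A" using that \<Omega>H by (auto simp: A_def)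
    have "g \<otimes> h \<otimes> inv h = g" using that(1) h(1) by (simp add: m_assoc)
    then show ?thesis
      using ball_height_mult[OF h(2), of h0 T g] ball_height_mult[OF h(3), of h0 T "g \<otimes> h"]
      by (simp add: f_def q_def) linarith
  qed
  have f_word: "\<bar>word_int f g s\<bar> \<le> real (length s)"
    if "g \<in> carrier G" "s \<in> words" "\<forall>h. Inr h \<in> set s \<longrightarrow> h \<in> \<Omega>" for g s
    using that
  proof (induction s arbitrary: g)
    case (Cons l s)
    have "\<bar>f g l\<bar> \<le> 1" using Cons.prems f_le by (cases l) (auto simp: f_def)
    moreover have "\<bar>word_int f (g \<otimes> lval l) s\<bar> \<le> real (length s)"
      using Cons.prems lval_closed[of l] by (intro Cons.IH) auto
    ultimately show ?case by simp
  qed simp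
  have bound: "\<bar>word_int f g s\<bar> \<le> B" if "g \<in> carrier G" "s \<in> S" for g s
  proof -
    have "\<bar>word_int f g s\<bar> \<le> real (length s)"
      using that S(2) by (intro f_word) (auto simp: \<Omega>_def)
    also have "\<dots> \<le> B"
      unfolding B_def of_nat_le_iff using that(2) S(1) by (intro member_le_sum) auto
    finally show ?thesis .
  qed
  have "0 \<le> B" by (simp add: B_def sum_nonneg)
  then have loop: "\<bar>word_int f g w\<bar> \<le> K * B * real (length w)" if "g \<in> carrier G" "w \<in> words" "val w = \<one>" for g w
    using dual[OF f _ _ that] bound by blast
  have adm: "word_int f u (path_word p) = 0" if "admissible_path G X H u p v" for u p v
    using that
  proof (induction p arbitrary: u)
    case (Cons e p)
    have e: "u \<in> carrier G" "fst e = u" "snd e \<in> X <+> H"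
      using Cons.prems by (auto simp: admissible_path_def awalk_Cons)
    have "admissible_path G X H (u \<otimes> letter_val (snd e)) p v"
      using Cons.prems by (auto simp: admissible_path_def awalk_Cons)
    moreover have "f u (to_letter (snd e)) = 0"
    proof (cases "snd e")
      case (Inr h)
      then have "u \<notin> H"
        using Cons.prems e by (cases e) (auto simp: admissible_path_def cayley_subgraph_def)
      then show ?thesis using Inr by (simp add: f_def to_letter_def)
    qed (simp add: f_def to_letter_def)
    ultimately show ?case
      using Cons.IH to_letter[OF e(3)] by (simp add: path_word_def)
  qed (simp add: path_word_def)
  have "h \<in> word_ball h0 A T" if h: "h \<in> H" "rel_dist G X H h0 h \<le> enat n" for h
  proof (rule ccontr)
    assume "h \<notin> word_ball h0 A T"
    then have q: "q h = real T" by (simp add: q_def ball_height_outside)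
    have "\<exists>p. admissible_path G X H h0 p h \<and> length p \<le> n"
    proof (rule ccontr)
      assume "\<not> ?thesis"
      then have "enat (Suc n) \<le> rel_dist G X H h0 h"
        unfolding rel_dist_def by (intro INF_greatest) (auto simp: not_le Suc_le_eq)
      then have "enat (Suc n) \<le> enat n" using h(2) by (rule order_trans)
      then show False by simp
    qed
    then obtain p where p: "admissible_path G X H h0 p h" "length p \<le> n" by blast
    define w where "w = path_word p @ [Inr (inv h \<otimes> h0)]"
    have pw: "path_word p \<in> words" "h0 \<otimes> val (path_word p) = h"
      using p(1) path_word by (auto simp: admissible_path_def)
    have hc: "h0 \<in> carrier G" "h \<in> carrier G" using h0 h by auto
    have w: "w \<in> words" using pw h0 h by (simp add: w_def)
    have "h0 \<otimes> val w = h0"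
      using pw hc h h0 by (simp add: w_def m_assoc[symmetric])
    then have "val w = \<one>" using w hc by simp
    then have "\<bar>word_int f h0 w\<bar> \<le> K * B * real (length w)" using loop w hc by blast
    also have "\<dots> \<le> K * B * real (Suc n)"
      using p(2) K \<open>0 \<le> B\<close> by (intro mult_left_mono) (auto simp: w_def)
    also have "\<dots> < real T" unfolding T_def by linarith
    finally have "\<bar>word_int f h0 w\<bar> < real T" .
    moreover have "word_int f h0 w = q h0 - q h"
      using pw adm[OF p(1)] hc h h0
      by (simp add: w_def f_def m_assoc[symmetric])
    moreover have "q h0 = 0" by (simp add: q_def ball_height_self)
    ultimately show False using q by simp
  qed
  then have "{h \<in> H. rel_dist G X H h0 h \<le> enat n} \<subseteq> word_ball h0 A T" by blast
  then show ?thesis using finite_word_ball[OF finA] finite_subset by blast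
qed

section \<open>From hyperbolic embedding to isoperimetry\<close>

text \<open>A loop shorter than \<open>2 * m\<close> can be replaced by the empty word. A longer one
  has a subpath of length \<open>2 * m\<close> that is not geodesic, by
  \<open>slim_loop_not_local_geodesic\<close>, and its label can be replaced by a shortest
  word.\<close>

lemma nongeodesic_subword:
  assumes slim: "\<And>N. M.slim \<delta> N" and m: "m = 2 * \<delta> + 1"
    and w: "w \<in> words" "val w = \<one>" "w \<noteq> []"
  obtains a u b u' where "w = a @ u @ b" "length u \<le> 2 * m" "u' \<in> words" "val u' = val u" "length u' < length u"
proof (cases "2 * m \<le> length w")
  case False
  then show ?thesis using that[of "[]" w "[]" "[]"] w by simp
next
  case True
  define c where "c = (\<lambda>i. val (take i w))"
  have c: "c i \<in> carrier G" for i using words_take_drop[OF w(1)] by (simp add: c_def)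
  have "c (length w) = c 0" using w(2) by (simp add: c_def)
  then obtain k where k: "k + 2 * m \<le> length w" "\<not> M.geod (\<lambda>i. c (k + i)) (2 * m)"
    using M.slim_loop_not_local_geodesic[OF slim m True, of c] c by blast
  have step: "word_dist (c i) (c (Suc i)) \<le> 1" if "i < length w" for i
  proof -
    have "w ! i \<in> (X \<times> UNIV) <+> H" using that w(1) by (auto simp: rel_words_def)
    moreover have "c (Suc i) = c i \<otimes> lval (w ! i)"
      using that words_take_drop[OF w(1), of i] \<open>w ! i \<in> _\<close>
      by (simp add: c_def take_Suc_conv_app_nth lval_closed)
    ultimately show ?thesis using word_dist_step[OF c] by simp
  qed
  have short: "word_dist (c k) (c (k + 2 * m)) < 2 * m"
  proof (rule ccontr)
    assume "\<not> ?thesis"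
    then have "M.geod (\<lambda>i. c (k + i)) (2 * m)"
      using k(1) step[of "k + _"] by (intro M.geodI) (simp_all add: c)
    then show False using k(2) by simp
  qed
  define u where "u = take (2 * m) (drop k w)"
  have u: "u \<in> words" using words_take_drop w(1) by (simp add: u_def)
  have len: "length u = 2 * m" using k(1) by (simp add: u_def)
  have "take (k + 2 * m) w = take k w @ u" by (simp add: u_def take_add)
  then have cu: "c (k + 2 * m) = c k \<otimes> val u" using u words_take_drop[OF w(1), of k] by (simp add: c_def)
  obtain u' where u': "u' \<in> words" "length u' = word_dist (c k) (c (k + 2 * m))" "c k \<otimes> val u' = c (k + 2 * m)"
    by (rule shortest_word[OF c c])
  have "val u' = val u" using u'(1,3) cu u c[of k] by simp
  moreover have "w = take k w @ u @ drop (2 * m) (drop k w)"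
    by (simp only: u_def append_take_drop_id)
  ultimately show ?thesis using that[of "take k w" u "drop (2 * m) (drop k w)" u'] u' len short by simp
qed

text \<open>Dehn's algorithm.\<close>

lemma filling_by_short_loops:
  assumes slim: "\<And>N. M.slim \<delta> N" and m: "m = 2 * \<delta> + 1"
  shows "w \<in> words \<Longrightarrow> val w = \<one> \<Longrightarrow>
    F.filling (cls ` {s \<in> words. val s = \<one> \<and> length s \<le> 4 * m}) (length w) (cls w)"
proof (induction "length w" arbitrary: w rule: less_induct)
  case less
  let ?S = "cls ` {s \<in> words. val s = \<one> \<and> length s \<le> 4 * m}"
  have S: "?S \<subseteq> carrier F" by auto
  show ?case
  proof (cases "w = []")
    case True
    then show ?thesis using F.filling.one by (simp add: cls_Nil)
  next
    case False
    obtain a u b u' where u: "w = a @ u @ b" "length u \<le> 2 * m" "u' \<in> words" "val u' = val u" "length u' < length u"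
      by (rule nongeodesic_subword[OF slim m less.prems False])
    have words: "a \<in> words" "u \<in> words" "b \<in> words" using less.prems(1) u(1) by auto
    \<comment> \<open>One move writes \<open>w\<close> as a conjugate of \<open>s\<close> by
      \<open>a\<close> times the shorter word \<open>w'\<close>. As \<open>u\<close> has length at
      most \<open>2 * m\<close> and \<open>u'\<close> is shorter, \<open>s\<close> stays within
      \<open>4 * m\<close>; as each move saves a letter, \<open>length w\<close> moves
      suffice.\<close>
    define s where "s = u @ winv u'"
    have s: "s \<in> words" "val s = \<one>" "length s \<le> 4 * m" using u words by (simp_all add: s_def)
    define w' where "w' = a @ u' @ b"
    have w': "w' \<in> words" "val w' = \<one>" "length w' < length w"
      using u words less.prems by (simp_all add: w'_def)
    have IH: "F.filling ?S (length w') (cls w')" using less.hyps w' by blast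
    have "F.filling ?S 1 (cls s)" using s by (intro F.filling_generator S) auto
    then have "F.filling ?S 1 (cls a \<otimes>\<^bsub>F\<^esub> cls s \<otimes>\<^bsub>F\<^esub> inv\<^bsub>F\<^esub> cls a)"
      by (rule F.filling_conj'[OF _ _ S]) (use words in simp)
    then have "F.filling ?S (1 + length w') (cls a \<otimes>\<^bsub>F\<^esub> cls s \<otimes>\<^bsub>F\<^esub> inv\<^bsub>F\<^esub> cls a \<otimes>\<^bsub>F\<^esub> cls w')"
      by (rule F.filling_mult[OF _ IH S])
    moreover have "cls a \<otimes>\<^bsub>F\<^esub> cls s \<otimes>\<^bsub>F\<^esub> inv\<^bsub>F\<^esub> cls a \<otimes>\<^bsub>F\<^esub> cls w' = cls w"
    proof -
      have l: "inv\<^bsub>F\<^esub> x \<otimes>\<^bsub>F\<^esub> (x \<otimes>\<^bsub>F\<^esub> y) = y" if "x \<in> carrier F" "y \<in> carrier F" for x y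
        using that by (simp add: F.m_assoc[symmetric])
      show ?thesis using words u(3)
        by (simp add: u(1) s_def w'_def cls_append cls_winv F.m_assoc l)
    qed
    ultimately show ?thesis using F.filling_le[of ?S "1 + length w'" "cls w" "length w"] w'(3) by simp
  qed
qed

lemma word_path_arc:
  "(g, e) \<in> set (word_path u w) \<Longrightarrow> u \<in> carrier G \<Longrightarrow> w \<in> words \<Longrightarrow>
     \<exists>a l b. w = a @ l # b \<and> g = u \<otimes> val a \<and> e = of_letter l"
proof (induction w arbitrary: u)
  case (Cons l w)
  have l: "lval l \<in> carrier G" "w \<in> words" using Cons.prems lval_closed by simp_all
  show ?case
  proof (cases "(g, e) = (u, of_letter l)")
    case True
    then show ?thesis using Cons.prems by (intro exI[of _ "[]"] exI[of _ l] exI[of _ w]) simp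
  next
    case False
    then have "(g, e) \<in> set (word_path (u \<otimes> lval l) w)" using Cons.prems(1) by auto
    then obtain a l' b where a: "w = a @ l' # b" "g = u \<otimes> lval l \<otimes> val a" "e = of_letter l'"
      using Cons.IH l Cons.prems(2) by blast
    then have "a \<in> words" using l(2) by simp
    then show ?thesis using a l Cons.prems(2)
      by (intro exI[of _ "l # a"] exI[of _ l'] exI[of _ b]) (simp add: m_assoc)
  qed
qed simp

text \<open>If an edge of a short loop labelled in \<open>H\<close> is connected to another such edge, the loop
  splits into two shorter ones; otherwise the rest of the loop is an admissible path.\<close>

lemma filling_short_loop:
  fixes n :: nat
  assumes X: "inv_closed G X"
    and \<Omega>: "\<Omega> = {h \<in> H. rel_dist G X H \<one> (inv h) \<le> enat n}"
    and R: "R = cls ` {s \<in> words. val s = \<one> \<and> length s \<le> n \<and> (\<forall>h. Inr h \<in> set s \<longrightarrow> h \<in> \<Omega>)}"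
  shows "w \<in> words \<Longrightarrow> val w = \<one> \<Longrightarrow> length w \<le> n \<Longrightarrow> F.filling R (2 ^ length w) (cls w)"
proof (induction "length w" arbitrary: w rule: less_induct)
  case less
  have RF: "R \<subseteq> carrier F" by (auto simp: R)
  show ?case
  proof (cases "\<forall>h. Inr h \<in> set w \<longrightarrow> h \<in> \<Omega>")
    case True
    then have "cls w \<in> R" using less.prems by (auto simp: R)
    then have "F.filling R 1 (cls w)" by (rule F.filling_generator[OF _ RF])
    then show ?thesis by (rule F.filling_le) simp
  next
    case False
    then obtain h where h: "Inr h \<in> set w" "h \<notin> \<Omega>" by blast
    obtain a b where w: "w = a @ Inr h # b" using split_list[OF h(1)] by blast
    have ab: "a \<in> words" "b \<in> words" "h \<in> H" using less.prems(1) w by auto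
    \<comment> \<open>Read from the end of the edge labelled \<open>h\<close>, the rest of the loop
      is a path from the identity to \<open>inv h\<close>. This is why \<Omega> is defined by the
      distance to \<open>inv h\<close>.\<close>
    define v where "v = b @ a"
    have v: "v \<in> words" "length w = Suc (length v)" using ab w by (simp_all add: v_def)
    have "val a \<otimes> (h \<otimes> val b) = \<one>" using less.prems(2) w ab by simp
    then have "(h \<otimes> val b) \<otimes> val a = \<one>" by (rule inv_comm) (use ab in simp_all)
    then have hv: "h \<otimes> val v = \<one>" using ab by (simp add: v_def m_assoc)
    then have "val v \<otimes> h = \<one>" by (rule inv_comm) (use ab v in simp_all)
    then have val_v: "val v = inv h" by (rule inv_equality[symmetric]) (use ab v in simp_all)
    have walk: "pre_digraph.awalk \<Gamma> \<one> (word_path \<one> v) (inv h)"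
      using word_path[OF X _ v(1), of \<one>] val_v ab by simp
    have "\<not> admissible_path G X H \<one> (word_path \<one> v) (inv h)"
    proof
      assume "admissible_path G X H \<one> (word_path \<one> v) (inv h)"
      then have "rel_dist G X H \<one> (inv h) \<le> enat (length v)"
        unfolding rel_dist_def by (intro INF_lower2[of "word_path \<one> v"]) auto
      also have "\<dots> \<le> enat n" using less.prems(3) v(2) by simp
      finally show False using h(2) ab(3) by (simp add: \<Omega>)
    qed
    then obtain g k where g: "(g, Inr k) \<in> set (word_path \<one> v)" "g \<in> H" "k \<in> H"
      using walk by (auto simp: admissible_path_def cayley_subgraph_def)
    obtain c l d where c: "v = c @ l # d" "g = \<one> \<otimes> val c" "Inr k = of_letter l"
      using word_path_arc[OF g(1) _ v(1)] by blast
    have l: "l = Inr k" using c(3) by (cases l) (auto simp: of_letter_def)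
    have cd: "c \<in> words" "d \<in> words" using v(1) c(1) by auto
    have gc: "val c = g" using c(2) cd by simp
    \<comment> \<open>The path \<open>v\<close> returns to \<open>H\<close> at \<open>g\<close> and
      then uses the edge labelled \<open>k\<close>. The chord from \<open>g\<close> back to the
      identity cuts off \<open>w1\<close>; the three consecutive \<open>H\<close>-edges
      \<open>h\<close>, \<open>g\<close>, \<open>k\<close> merge into the first letter of
      \<open>w2\<close>. Both loops are shorter than \<open>w\<close>, so the number of relators at
      most doubles per letter.\<close>
    define w1 where "w1 = c @ [Inr (inv g)]"
    define w2 where "w2 = Inr (h \<otimes> g \<otimes> k) # d"
    have w1: "w1 \<in> words" "val w1 = \<one>" "length w1 < length w"
      using cd gc g v(2) c(1) by (simp_all add: w1_def)
    have w2: "w2 \<in> words" "length w2 < length w"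
      using cd ab g v(2) c(1) by (simp_all add: w2_def)
    have val_w2: "val w2 = \<one>"
      using hv cd ab g gc by (simp add: w2_def c(1) l m_assoc)
    have fill: "F.filling R (2 ^ length v) (cls u)"
      if "u \<in> words" "val u = \<one>" "length u < length w" for u
    proof -
      have "F.filling R (2 ^ length u) (cls u)" using less.hyps that less.prems(3) by simp
      then show ?thesis by (rule F.filling_le) (use that(3) v(2) in simp)
    qed
    have "F.filling R (2 ^ length v + 2 ^ length v)
        (cls [Inr h] \<otimes>\<^bsub>F\<^esub> cls w1 \<otimes>\<^bsub>F\<^esub> inv\<^bsub>F\<^esub> cls [Inr h] \<otimes>\<^bsub>F\<^esub> cls w2)"
      using ab by (intro F.filling_mult F.filling_conj' fill w1 w2 val_w2 RF) simp_all
    moreover have "cls [Inr h] \<otimes>\<^bsub>F\<^esub> cls w1 \<otimes>\<^bsub>F\<^esub> inv\<^bsub>F\<^esub> cls [Inr h] \<otimes>\<^bsub>F\<^esub> cls w2 = cls (Inr h # v)"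
    proof -
      have inverse: "cls [Inr (inv x)] = inv\<^bsub>F\<^esub> cls [Inr x]" if "x \<in> H" for x
        using cls_letter_inv[of "Inr x"] that by (simp add: letter_inv_def)
      have mult: "cls [Inr (x \<otimes> y)] = cls [Inr x] \<otimes>\<^bsub>F\<^esub> cls [Inr y]" if "x \<in> H" "y \<in> H" for x y
        using cls_mult[OF that] cls_append[of "[Inr x]" "[Inr y]"] that by simp
      have cancel: "inv\<^bsub>F\<^esub> x \<otimes>\<^bsub>F\<^esub> (x \<otimes>\<^bsub>F\<^esub> y) = y" if "x \<in> carrier F" "y \<in> carrier F" for x y
        using that by (simp add: F.m_assoc[symmetric])
      have "cls w2 = cls [Inr h] \<otimes>\<^bsub>F\<^esub> cls [Inr g] \<otimes>\<^bsub>F\<^esub> cls [Inr k] \<otimes>\<^bsub>F\<^esub> cls d"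
        using cls_append[of "[Inr (h \<otimes> g \<otimes> k)]" d] cd ab g by (simp add: w2_def mult)
      moreover have "cls w1 = cls c \<otimes>\<^bsub>F\<^esub> inv\<^bsub>F\<^esub> cls [Inr g]"
        using cls_append[of c "[Inr (inv g)]"] cd g by (simp add: w1_def inverse)
      moreover have "cls (Inr h # v) = cls [Inr h] \<otimes>\<^bsub>F\<^esub> (cls c \<otimes>\<^bsub>F\<^esub> (cls [Inr k] \<otimes>\<^bsub>F\<^esub> cls d))"
        using cls_append[of "[Inr h]" v] cls_append[of c "l # d"] cls_append[of "[l]" d] cd ab g v(1)
        by (simp add: c(1) l)
      ultimately show ?thesis using cd ab g by (simp add: F.m_assoc cancel)
    qed
    moreover have "cls (Inr h # v) = inv\<^bsub>F\<^esub> cls a \<otimes>\<^bsub>F\<^esub> cls w \<otimes>\<^bsub>F\<^esub> cls a"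
      using cls_append[of a "Inr h # b"] cls_append[of "Inr h # b" a] ab
      by (simp add: w v_def F.m_assoc[symmetric])
    ultimately have "F.filling R (2 ^ length v + 2 ^ length v) (inv\<^bsub>F\<^esub> cls a \<otimes>\<^bsub>F\<^esub> cls w \<otimes>\<^bsub>F\<^esub> cls a)" by simp
    then have "F.filling R (2 ^ length v + 2 ^ length v) (cls w)"
      by (rule F.filling_conj_iff) (use ab less.prems RF in simp_all)
    then show ?thesis by (simp add: v(2) mult_2)
  qed
qed

theorem relatively_hyperbolic_if_hyperbolically_embedded:
  assumes fin: "finite X" and X: "inv_closed G X" and emb: "hyperbolically_embedded G H X"
  shows "relatively_hyperbolic G H"
proof -
  obtain \<delta> where slim: "\<And>N. M.slim \<delta> N"
    using emb hyperbolic_graph_iff[OF X] unfolding hyperbolically_embedded_def by blast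
  define m where "m = 2 * \<delta> + 1"
  \<comment> \<open>The length bound for the loops in Dehn's algorithm. Since it is fixed, the
    exponential count of \<open>filling_short_loop\<close> becomes the constant factor
    \<open>2 ^ n\<close> of a linear inequality.\<close>
  define n where "n = 4 * m"
  define \<Omega> where "\<Omega> = {h \<in> H. rel_dist G X H \<one> (inv h) \<le> enat n}"
  define L where "L = {s \<in> words. val s = \<one> \<and> length s \<le> n \<and> (\<forall>h. Inr h \<in> set s \<longrightarrow> h \<in> \<Omega>)}"
  define R where "R = cls ` L"
  have R_def': "R = cls ` {s \<in> words. val s = \<one> \<and> length s \<le> n \<and> (\<forall>h. Inr h \<in> set s \<longrightarrow> h \<in> \<Omega>)}"
    by (simp add: R_def L_def)
  have "finite {h \<in> H. rel_dist G X H \<one> h \<le> enat n}"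
    using emb H.one_closed unfolding hyperbolically_embedded_def by blast
  moreover have "\<Omega> \<subseteq> m_inv G ` {h \<in> H. rel_dist G X H \<one> h \<le> enat n}"
  proof
    fix h assume "h \<in> \<Omega>"
    then have "h = inv (inv h)" "inv h \<in> {h \<in> H. rel_dist G X H \<one> h \<le> enat n}" by (auto simp: \<Omega>_def)
    then show "h \<in> m_inv G ` {h \<in> H. rel_dist G X H \<one> h \<le> enat n}" by blast
  qed
  ultimately have "finite \<Omega>" using finite_surj by blast
  then have "finite {s. set s \<subseteq> (X \<times> (UNIV :: bool set)) <+> \<Omega> \<and> length s \<le> n}"
    using fin by (intro finite_lists_length_le finite_Plus) auto
  moreover have "L \<subseteq> {s. set s \<subseteq> (X \<times> UNIV) <+> \<Omega> \<and> length s \<le> n}"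
    by (auto simp: L_def rel_words_def)
  ultimately have "finite L" by (rule rev_finite_subset)
  then have finR: "finite R" by (simp add: R_def)
  have RF: "R \<subseteq> carrier F" by (auto simp: R_def L_def)
  have fill: "F.filling R (length w * 2 ^ n) (cls w)" if "w \<in> words" "val w = \<one>" for w
  proof (rule F.filling_trans[OF filling_by_short_loops[OF slim m_def that] _ RF])
    fix s assume "s \<in> cls ` {s \<in> words. val s = \<one> \<and> length s \<le> 4 * m}"
    then obtain u where u: "s = cls u" "u \<in> words" "val u = \<one>" "length u \<le> n" by (auto simp: n_def)
    have "F.filling R (2 ^ length u) (cls u)"
      by (rule filling_short_loop[OF X \<Omega>_def R_def' u(2-4)])
    then show "F.filling R (2 ^ n) s" unfolding u(1) by (rule F.filling_le) (use u(4) in simp)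
  qed
  interpret epi: group_hom F G "natural_epi G"
    by unfold_locales (rule natural_epi_hom[OF group_axioms H.subgroup_axioms X_carrier])
  have "normal_closure F R = kernel F G (natural_epi G)"
  proof (rule F.normal_closureI_filling[OF epi.normal_kernel])
    show "R \<subseteq> kernel F G (natural_epi G)" by (auto simp: R_def L_def kernel_def)
    show "\<exists>k. F.filling R k u" if u: "u \<in> kernel F G (natural_epi G)" for u
    proof -
      obtain w where "w \<in> words" "u = cls w" "val w = \<one>"
        using u by (auto simp: kernel_def F_carrier)
      then show ?thesis using fill by blast
    qed
  qed
  moreover have "linear_rel_isoperimetric G H X R"
    unfolding linear_rel_isoperimetric_def
  proof (intro exI[of _ "2 ^ n"] ballI impI)
    fix w assume w: "w \<in> words" "val w = \<one>"
    obtain frs where frs: "set frs \<subseteq> carrier F \<times> (R \<union> m_inv F ` R)"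
        "cls w = foldr (\<otimes>\<^bsub>F\<^esub>) (map (\<lambda>(f, r). inv\<^bsub>F\<^esub> f \<otimes>\<^bsub>F\<^esub> r \<otimes>\<^bsub>F\<^esub> f) frs) \<one>\<^bsub>F\<^esub>"
        "length frs \<le> length w * 2 ^ n"
      using F.filling_list[OF fill[OF w]] by blast
    have "real (length frs) \<le> real (length w * 2 ^ n)" using frs(3) by (rule of_nat_mono)
    then show "\<exists>frs. set frs \<subseteq> carrier F \<times> (R \<union> m_inv F ` R) \<and>
        cls w = foldr (\<otimes>\<^bsub>F\<^esub>) (map (\<lambda>(f, r). inv\<^bsub>F\<^esub> f \<otimes>\<^bsub>F\<^esub> r \<otimes>\<^bsub>F\<^esub> f) frs) \<one>\<^bsub>F\<^esub> \<and>
        real (length frs) \<le> 2 ^ n * real (length w)"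
      using frs by (intro exI[of _ frs]) (simp add: mult.commute)
  qed
  ultimately show ?thesis unfolding relatively_hyperbolic_def using fin gens finR RF by blast
qed

end

section \<open>Symmetric generating sets and the two equivalences\<close>

lemma generates_over_Un_inv:
  assumes G: "group G" and "subgroup H G" and Y: "generates_over G H Y"
  shows "generates_over G H (Y \<union> m_inv G ` Y)"
proof -
  interpret group G by (rule G)
  have sub: "Y \<union> m_inv G ` Y \<subseteq> carrier G" using Y by (auto simp: generates_over_def)
  moreover have "H \<subseteq> carrier G" using assms(2) by (rule subgroup.subset)
  ultimately have "generate G (Y \<union> m_inv G ` Y \<union> H) \<subseteq> carrier G"
    by (intro generate_incl) simp
  moreover have "generate G (Y \<union> H) \<subseteq> generate G (Y \<union> m_inv G ` Y \<union> H)"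
    by (intro mono_generate) auto
  ultimately show ?thesis using Y sub by (auto simp: generates_over_def)
qed

text \<open>The set \<open>Y\<close> of the relative presentation need bear no relation to the given
  \<open>X\<close>. The dual inequality is derived over \<open>Y\<close>, transferred to
  \<open>X\<close>, and only there turned into hyperbolicity and finiteness of balls.\<close>

lemma hyperbolically_embedded_if_relatively_hyperbolic:
  assumes G: "group G" and H: "subgroup H G" and rel: "relatively_hyperbolic G H"
    and X: "finite X" "inv_closed G X" "generates_over G H X"
  shows "hyperbolically_embedded G H X"
proof -
  obtain Y R where Y: "generates_over G H Y" and R: "finite R" "R \<subseteq> carrier (free_prod G H Y)"
    "normal_closure (free_prod G H Y) R = kernel (free_prod G H Y) G (natural_epi G)"
    "linear_rel_isoperimetric G H Y R"
    using rel unfolding relatively_hyperbolic_def by blast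
  have genY: "rel_generated G H Y" and genX: "rel_generated G H X"
    using G H X(3) Y by (simp_all add: rel_generated_def rel_generated_axioms_def)
  interpret X: rel_generated G H X by (rule genX)
  have "R \<subseteq> kernel (free_prod G H Y) G (natural_epi G)"
    unfolding R(3)[symmetric] normal_closure_def by blast
  then have "rel_generated.dual_linear_isoperimetric G H Y"
    by (rule rel_generated.dual_if_linear_rel_isoperimetric[OF genY R(1) _ R(4)])
  then have "X.dual_linear_isoperimetric"
    by (rule X.dual_linear_isoperimetric_transfer[OF genY _ X(1)])
  then show ?thesis
    unfolding hyperbolically_embedded_def
    using X X.hyperbolic_if_dual_linear_isoperimetric
      X.finite_rel_dist_balls_if_dual_linear_isoperimetric by blast
qed

theorem proposition2p4:
  fixes G :: "('a, 'b) monoid_scheme" and H :: "'a set"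
  assumes "group G" and "subgroup H G"
  shows "(relatively_hyperbolic G H \<longleftrightarrow>
            (\<exists>X. finite X \<and> inv_closed G X \<and> generates_over G H X \<and>
                 hyperbolically_embedded G H X)) \<and>
         ((\<exists>Y. finite Y \<and> generates_over G H Y) \<longrightarrow>
            (relatively_hyperbolic G H \<longleftrightarrow>
              (\<forall>X. finite X \<and> inv_closed G X \<and> generates_over G H X \<longrightarrow>
                   hyperbolically_embedded G H X)))"
proof -
  interpret group G by (rule assms(1))
  have to: "hyperbolically_embedded G H X"
    if "relatively_hyperbolic G H" "finite X" "inv_closed G X" "generates_over G H X" for X
    by (rule hyperbolically_embedded_if_relatively_hyperbolic[OF assms that])
  have from_emb: "relatively_hyperbolic G H"
    if "finite X" "inv_closed G X" "generates_over G H X" "hyperbolically_embedded G H X" for X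
  proof -
    interpret X: rel_generated G H X
      using assms that(3) by (simp add: rel_generated_def rel_generated_axioms_def)
    show ?thesis by (rule X.relatively_hyperbolic_if_hyperbolically_embedded[OF that(1,2,4)])
  qed
  \<comment> \<open>Without a finite symmetric generating set the statement for all such sets would
    hold vacuously; adding inverses to \<open>Y\<close> provides one.\<close>
  have symm: "\<exists>X. finite X \<and> inv_closed G X \<and> generates_over G H X"
    if "finite Y" "generates_over G H Y" for Y
  proof (intro exI conjI)
    show "finite (Y \<union> m_inv G ` Y)" using that(1) by simp
    show "inv_closed G (Y \<union> m_inv G ` Y)"
      using that(2) by (auto simp: inv_closed_def generates_over_def subset_iff)
    show "generates_over G H (Y \<union> m_inv G ` Y)"
      by (rule generates_over_Un_inv[OF assms that(2)])
  qed
  \<comment> \<open>The first equivalence assumes no finite relative generating set; relative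
    hyperbolicity itself supplies it.\<close>
  have gen: "\<exists>Y. finite Y \<and> generates_over G H Y" if "relatively_hyperbolic G H"
    using that unfolding relatively_hyperbolic_def by blast
  show ?thesis
    using to from_emb symm gen by meson
qed

end
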